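(* In the setting of the stochastic APP algorithm described in the context, assume: (a) (linearly bounded subgradients) there exist $c_1,c_2>0$ such that $\|r\|_\star\le c_1\|u\|+c_2$ for all $(u,w)\in U^{\mathrm{ad}}\times\mathbb{W}$ and all $r\in\partial_u j^{C}(u,w)$, and there exist $d_1,d_2>0$ such that $\|s\|_\star\le d_1\|u\|+d_2$ for all $(u,w)\in U^{\mathrm{ad}}\times\mathbb{W}$ and all $s\in\partial_u j^{\Sigma}(u,w)$; (b) $J$ is coercive on $U^{\mathrm{ad}}$; (c) $K$ is $b$-strongly convex for some $b>0$, i.e. $K(v)\ge K(u)+\langle\nabla K(u),v-u\rangle+\frac b2\|u-v\|^2$ for all $u,v\in\mathbb{U}$, and $\nabla K$ is $L_K$-Lipschitz for some $L_K>0$, i.e. $\|\nabla K(v)-\nabla K(u)\|_\star\le L_K\|v-u\|$ for all $u,v\in\mathbb{U}$; (d) $\varepsilon_k>0$ for all $k$, $\sum_k\varepsilon_k=+\infty$ and $\sum_k\varepsilon_k^2<+\infty$; (e) each $\mathbf{R}_k$ is $\mathcal{F}_{k+1}$-measurable, the sequence $\{\mathbf{R}_k\}_{k\in\mathbb{N}}$ is $\mathbb{P}$-almost surely bounded, and $\sum_{k\in\mathbb{N}}\varepsilon_k\,\mathbb{E}\big(\|\mathbf{R}_k\|_\star\mid\mathcal{F}_k\big)<+\infty$ $\mathbb{P}$-almost surely; (f) the differential $\nabla K:\mathbb{U}\to\mathbb{U}^\star$ is weakly continuous (continuous from the weak topology of $\mathbb{U}$ to the weak topology of $\mathbb{U}^\star$).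 Then the sequence of iterates $\{\mathbf{U}_k\}_{k\in\mathbb{N}}$ converges weakly, $\mathbb{P}$-almost surely, to a single element of $U^\sharp$. If moreover the function $J^{C}$ is strongly convex, then $\{\mathbf{U}_k\}_{k\in\mathbb{N}}$ converges strongly, $\mathbb{P}$-almost surely, to the unique solution $u^\sharp$ of $\min_{u\in U^{\mathrm{ad}}}J(u)$.
   Context: Setting. $\mathbb{U}$ is a reflexive separable Banach space with norm $\|\cdot\|$, dual $\mathbb{U}^\star$, dual norm $\|\cdot\|_\star$, duality pairing $\langle\cdot,\cdot\rangle$; $(\Omega,\mathcal{A},\mathbb{P})$ is a probability space with $\mathcal{A}$ complete for $\mathbb{P}$; $\mathbb{W}$ is a topological vector space with its Borel $\sigma$-field; $U^{\mathrm{ad}}\subset\mathbb{U}$ is non-empty, closed, convex. $j^{C},j^{\Sigma}:\mathbb{U}\times\mathbb{W}\to\mathbb{R}$ are jointly lower semicontinuous; for all $w$, $j^{C}(\cdot,w)$ and $j^{\Sigma}(\cdot,w)$ are proper and convex, and $j^{C}(\cdot,w)$ is subdifferentiable on an open set containing $U^{\mathrm{ad}}$. $K:\mathbb{U}\to\mathbb{R}$ is convex, lower semicontinuous and Gateaux-differentiable (on an open set containing $U^{\mathrm{ad}}$, and everywhere where $\nabla K$ is used). $\mathbf{W}:\Omega\to\mathbb{W}$ is a random variable, $J^{C}(u)=\mathbb{E}(j^{C}(u,\mathbf{W}))$, $J^{\Sigma}(u)=\mathbb{E}(j^{\Sigma}(u,\mathbf{W}))$, $J=J^{C}+J^{\Sigma}$;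 these expectations are understood to be well defined, with $J$ finite on $U^{\mathrm{ad}}$. The problem is $\min_{u\in U^{\mathrm{ad}}}J(u)$; $U^\sharp$ is its set of solutions (non-empty under coercivity of $J$). A function is coercive on $U^{\mathrm{ad}}$ if it tends to $+\infty$ when $\|u\|\to+\infty$, $u\in U^{\mathrm{ad}}$. Algorithm. $\mathbf{W}_1,\mathbf{W}_2,\ldots$ are independent random variables distributed as $\mathbf{W}$, $\mathcal{F}_k=\sigma(\mathbf{W}_1,\ldots,\mathbf{W}_k)$; $\varepsilon_k>0$ are step sizes; $\mathbf{R}_k:\Omega\to\mathbb{U}^\star$ are measurable (additive errors). $\mathbf{U}_0\equiv u_0\in U^{\mathrm{ad}}$ and, for $k\in\mathbb{N}$, $\mathbf{G}_k:\Omega\to\mathbb{U}^\star$ is measurable with $\mathbf{G}_k(\omega)\in\partial_u j^{C}(\mathbf{U}_k(\omega),\mathbf{W}_{k+1}(\omega))$ for all $\omega$, and $\mathbf{U}_{k+1}(\omega)$ is the unique (as $K$ is strongly convex) minimizer over $u\in U^{\mathrm{ad}}$ of $$K(u)+\big\langle\varepsilon_k(\mathbf{G}_k(\omega)+\mathbf{R}_k(\omega))-\nabla K(\mathbf{U}_k(\omega)),u\big\rangle+\varepsilon_k\,j^{\Sigma}(u,\mathbf{W}_{k+1}(\omega)),$$ this function being coercive on $U^{\mathrm{ad}}$ for all $k$ and $\omega$. The iterates are adapted: $\mathbf{U}_k$ is $\mathcal{F}_k$-measurable for all $k$. *)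

theory Defs
  imports "HOL-Probability.Probability"
begin

text \<open>Real topological vector spaces; the Hausdorff property is not part of the definition.\<close>

class real_tvs = topological_ab_group_add + real_vector +
  assumes tendsto_scaleR_tvs:
    "LIM x (nhds a \<times>\<^sub>F nhds b). fst x *\<^sub>R snd x :> nhds (a *\<^sub>R b)"

text \<open>The dual of \<^typ>\<open>'a::real_normed_vector\<close> is the type of bounded linear functions into the
  reals with its operator norm; reflexivity is surjectivity of the canonical map into the bidual.\<close>

definition reflexive_space :: "'a::real_normed_vector itself \<Rightarrow> bool" where
  "reflexive_space _ \<longleftrightarrow>
     (\<forall>\<phi> :: ('a \<Rightarrow>\<^sub>L real) \<Rightarrow>\<^sub>L real. \<exists>x. \<forall>f. blinfun_apply \<phi> f = blinfun_apply f x)"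

text \<open>The coarsest topology making every bounded linear functional continuous: the function space
  carries the topology of pointwise convergence. On a dual space this is the topology
  induced by the bidual, not the weak-star topology.\<close>

definition weak_topology :: "'a::real_normed_vector topology" where
  "weak_topology =
     pullback_topology UNIV (\<lambda>x (f :: 'a \<Rightarrow>\<^sub>L real). blinfun_apply f x) euclidean"

lemma topspace_weak_topology [simp]: "topspace weak_topology = UNIV"
  by (simp add: weak_topology_def topspace_pullback_topology)

lemma limitin_weak_topology:
  "limitin weak_topology X l F \<longleftrightarrow>
     (\<forall>f :: 'a::real_normed_vector \<Rightarrow>\<^sub>L real. ((\<lambda>k. blinfun_apply f (X k)) \<longlongrightarrow> blinfun_apply f l) F)"
proof -
  have "limitin weak_topology X l F \<longleftrightarrow>
      ((\<lambda>k (f :: 'a \<Rightarrow>\<^sub>L real). blinfun_apply f (X k)) \<longlongrightarrow> (\<lambda>f. blinfun_apply f l)) F"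
    unfolding limitin_def tendsto_def
    by (auto simp: weak_topology_def openin_pullback_topology topspace_pullback_topology)
  then show ?thesis
    using limitin_componentwise[of "\<lambda>_ :: 'a \<Rightarrow>\<^sub>L real. euclidean :: real topology" UNIV
        "\<lambda>k f. blinfun_apply f (X k)" "\<lambda>f. blinfun_apply f l" F]
    by (simp add: euclidean_product_topology)
qed

definition lower_semicontinuous :: "('a::topological_space \<Rightarrow> real) \<Rightarrow> bool" where
  "lower_semicontinuous f \<longleftrightarrow> (\<forall>x a. a < f x \<longrightarrow> (\<forall>\<^sub>F y in nhds x. a < f y))"

definition subdifferential :: "('a::real_normed_vector \<Rightarrow> real) \<Rightarrow> 'a \<Rightarrow> ('a \<Rightarrow>\<^sub>L real) set" where
  "subdifferential f u = {r. \<forall>v. f v \<ge> f u + blinfun_apply r (v - u)}"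

definition has_gateaux_derivative ::
    "('a::real_normed_vector \<Rightarrow> real) \<Rightarrow> ('a \<Rightarrow>\<^sub>L real) \<Rightarrow> 'a \<Rightarrow> bool" where
  "has_gateaux_derivative f D u \<longleftrightarrow>
     (\<forall>h. ((\<lambda>t::real. f (u + t *\<^sub>R h)) has_real_derivative blinfun_apply D h) (at 0))"

definition coercive_on :: "'a::real_normed_vector set \<Rightarrow> ('a \<Rightarrow> real) \<Rightarrow> bool" where
  "coercive_on S f \<longleftrightarrow> filterlim f at_top (inf at_infinity (principal S))"

definition strongly_convex_on :: "'a::real_normed_vector set \<Rightarrow> real \<Rightarrow> ('a \<Rightarrow> real) \<Rightarrow> bool" where
  "strongly_convex_on S b f \<longleftrightarrow> convex S \<and>
     (\<forall>u\<in>S. \<forall>v\<in>S. \<forall>t\<in>{0..1}.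
        f (t *\<^sub>R u + (1 - t) *\<^sub>R v)
          \<le> t * f u + (1 - t) * f v - b / 2 * t * (1 - t) * (norm (u - v))\<^sup>2)"

definition expected_cost ::
    "'s measure \<Rightarrow> ('s \<Rightarrow> 'w) \<Rightarrow> ('u \<Rightarrow> 'w \<Rightarrow> real) \<Rightarrow> 'u \<Rightarrow> real" where
  "expected_cost M W j u = integral\<^sup>L M (\<lambda>\<omega>. j u (W \<omega>))"

definition total_cost ::
    "'s measure \<Rightarrow> ('s \<Rightarrow> 'w) \<Rightarrow> ('u \<Rightarrow> 'w \<Rightarrow> real) \<Rightarrow> ('u \<Rightarrow> 'w \<Rightarrow> real) \<Rightarrow> 'u \<Rightarrow> real" where
  "total_cost M W jC jS u = expected_cost M W jC u + expected_cost M W jS u"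

text \<open>The sigma-algebra generated by the observations with indices 1 to \<open>k\<close>; for \<open>k = 0\<close> it is the
  trivial one. Only the space and the measurable sets of this measure object are meaningful.\<close>

definition history ::
    "'s measure \<Rightarrow> (nat \<Rightarrow> 's \<Rightarrow> 'w::topological_space) \<Rightarrow> nat \<Rightarrow> 's measure" where
  "history M Ws k =
     sigma (space M) (\<Union>i\<in>{1..k}. {Ws i -` B \<inter> space M | B. B \<in> sets borel})"

text \<open>The function minimized at one step of the algorithm: step size \<open>e\<close>, sampled subgradient \<open>g\<close>,
  error \<open>r\<close>, current iterate \<open>x\<close>, sample \<open>w\<close>.\<close>

definition app_objective ::
    "('u::real_normed_vector \<Rightarrow> real) \<Rightarrow> ('u \<Rightarrow> 'u \<Rightarrow>\<^sub>L real) \<Rightarrow> ('u \<Rightarrow> 'w \<Rightarrow> real) \<Rightarrow>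
      real \<Rightarrow> ('u \<Rightarrow>\<^sub>L real) \<Rightarrow> ('u \<Rightarrow>\<^sub>L real) \<Rightarrow> 'u \<Rightarrow> 'w \<Rightarrow> 'u \<Rightarrow> real" where
  "app_objective K gradK jS e g r x w u =
     K u + blinfun_apply (e *\<^sub>R (g + r) - gradK x) u + e * jS u w"

end

theory Submission
  imports Defs
begin

text \<open>The proof separates the randomness from the dynamics. Fix a solution \<open>u\<close> and let \<open>D k\<close> be the
  Bregman distance of the iterate \<open>U k\<close> to \<open>u\<close> that is generated by the strongly convex function
  \<open>K\<close>. The variational inequality for one step and Young's inequality give
  (\<open>app_step_estimates\<close>) \<open>D (k+1) \<le> D k + \<epsilon> k * (\<xi> k - v k) + (errors)\<close>, where \<open>v k \<ge> 0\<close> is the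
  excess of the expected cost at \<open>U k\<close> over its minimum, \<open>\<xi> k\<close> is the centred sampling noise,
  and the errors are at most \<open>\<epsilon> k * norm (R k)\<close> or \<open>(\<epsilon> k)^2\<close> times a multiple of \<open>1 + D k\<close>.
  Linear growth of the subgradients also bounds \<open>\<xi> k\<close> by a multiple of \<open>1 + D k\<close>.

  Hence dividing by \<open>1 + D k\<close> makes the noise bounded by a multiple of \<open>\<epsilon> k\<close>. Being orthogonal
  to the past, the series of the normalized noise terms converges almost surely, because \<open>\<epsilon>\<close> is
  square summable (\<open>orthogonal_increments_summable\<close>, \<open>weighted_noise_summable\<close>). Taking
  logarithms of \<open>1 + D k\<close>, whose increments are at most the relative increments of \<open>1 + D k\<close>,
  shows that convergence of that series, be it only conditional, suffices: on almost every path
  \<open>D\<close> converges and \<open>\<epsilon> k * v k\<close> is summable (\<open>multiplicative_quasi_decreasing_convergent\<close>,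
  \<open>bregman_recursion_convergent\<close>). Since this is done path by path, a bound on the errors \<open>R k\<close>
  that depends on the path can be used as it is.

  The rest takes place on one path. The iterates are bounded and move by at most a multiple of
  \<open>\<epsilon> k\<close>, so \<open>v\<close> tends to \<open>0\<close> (\<open>tendsto_0_of_weighted_summable\<close>), and by Mazur's theorem every
  weak cluster point is a solution. If \<open>x\<close> and \<open>y\<close> are two of them, the difference of their
  Bregman distances to \<open>U k\<close> converges; since it is affine in the differential of \<open>K\<close> at \<open>U k\<close>,
  weak continuity of this differential forces \<open>x = y\<close>
  (\<open>weakly_convergent_of_bregman_convergent\<close>). Reflexivity yields the cluster points. The
  exceptional null set must not depend on the solution \<open>u\<close>; a countable dense set of solutions
  takes care of this (\<open>convergent_bregman_closure\<close>). If the expected cost is strongly convex,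
  the excess \<open>v k\<close> dominates the squared distance to the solution, which gives strong
  convergence.\<close>

section \<open>Hahn--Banach, subgradients and weak compactness\<close>

definition sublinear :: "('a::real_vector \<Rightarrow> real) \<Rightarrow> bool" where
  "sublinear p \<longleftrightarrow> (\<forall>x y. p (x + y) \<le> p x + p y) \<and> (\<forall>t\<ge>0. \<forall>x. p (t *\<^sub>R x) = t * p x)"

lemma sublinearD:
  assumes "sublinear p"
  shows "p (x + y) \<le> p x + p y" "0 \<le> t \<Longrightarrow> p (t *\<^sub>R x) = t * p x"
    "p 0 = 0" "- p (- x) \<le> p x"
proof -
  show *: "p (x + y) \<le> p x + p y" "0 \<le> t \<Longrightarrow> p (t *\<^sub>R x) = t * p x" for x y t
    using assms by (auto simp: sublinear_def)
  show "p 0 = 0" using *(2)[of 0] by simp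
  then show "- p (- x) \<le> p x" using *(1)[of x "- x"] by simp
qed

text \<open>The infimum of a family need not be attained and its members need not be sublinear one by one:
  it is enough that the family as a whole is closed, up to \<open>\<le>\<close>, under addition and positive
  scaling. Every sublinear functional constructed below is of this kind.\<close>
lemma sublinear_INF:
  fixes \<phi> :: "'i \<Rightarrow> 'a::real_vector \<Rightarrow> real"
  assumes ne: "I \<noteq> {}"
    and bdd: "\<And>i y. i \<in> I \<Longrightarrow> l y \<le> \<phi> i y"
    and add: "\<And>i j y z. i \<in> I \<Longrightarrow> j \<in> I \<Longrightarrow> \<exists>k\<in>I. \<phi> k (y + z) \<le> \<phi> i y + \<phi> j z"
    and scale: "\<And>i s y. i \<in> I \<Longrightarrow> s > 0 \<Longrightarrow> \<exists>j\<in>I. s * \<phi> j y \<le> \<phi> i (s *\<^sub>R y)"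
  shows "sublinear (\<lambda>y. INF i\<in>I. \<phi> i y)" "\<And>i y. i \<in> I \<Longrightarrow> (INF i\<in>I. \<phi> i y) \<le> \<phi> i y"
proof -
  define p where "p = (\<lambda>y. INF i\<in>I. \<phi> i y)"
  show le: "(INF i\<in>I. \<phi> i y) \<le> \<phi> i y" if "i \<in> I" for i y
    by (rule cINF_lower[OF _ that]) (use bdd in \<open>auto intro!: bdd_belowI2\<close>)
  then have le': "p y \<le> \<phi> i y" if "i \<in> I" for i y using that by (simp add: p_def)
  have ge: "c \<le> p y" if "\<And>i. i \<in> I \<Longrightarrow> c \<le> \<phi> i y" for c y
    unfolding p_def by (rule cINF_greatest[OF ne]) (rule that)
  have super: "s * p y \<le> p (s *\<^sub>R y)" if "s > 0" for s y
  proof (rule ge)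
    fix i assume "i \<in> I"
    then obtain j where "j \<in> I" "s * \<phi> j y \<le> \<phi> i (s *\<^sub>R y)" using scale \<open>s > 0\<close> by blast
    moreover have "s * p y \<le> s * \<phi> j y" using le'[OF \<open>j \<in> I\<close>] \<open>s > 0\<close> by simp
    ultimately show "s * p y \<le> \<phi> i (s *\<^sub>R y)" by linarith
  qed
  have hom: "p (s *\<^sub>R y) = s * p y" if "s > 0" for s y
  proof -
    have "(1/s) * p (s *\<^sub>R y) \<le> p ((1/s) *\<^sub>R (s *\<^sub>R y))" by (rule super) (use that in simp)
    then have "p (s *\<^sub>R y) \<le> s * p y" using that by (simp add: field_simps)
    with super[OF that] show ?thesis by (rule antisym[rotated])
  qed
  \<comment> \<open>Positive homogeneity already forces the value \<open>0\<close> at the origin.\<close>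
  have "p 0 = 0" using hom[of 2 0] by simp
  with hom have hom0: "p (s *\<^sub>R y) = s * p y" if "s \<ge> 0" for s y
    using that by (cases "s = 0") auto
  have "p (y + z) \<le> p y + p z" for y z
  proof -
    have "p (y + z) - p z \<le> p y"
    proof (rule ge)
      fix i assume i: "i \<in> I"
      have "p (y + z) - \<phi> i y \<le> p z"
      proof (rule ge)
        fix j assume "j \<in> I"
        then obtain k where "k \<in> I" "\<phi> k (y + z) \<le> \<phi> i y + \<phi> j z" using add i by blast
        with le'[of k "y + z"] show "p (y + z) - \<phi> i y \<le> \<phi> j z" by linarith
      qed
      then show "p (y + z) - p z \<le> \<phi> i y" by linarith
    qed
    then show ?thesis by linarith
  qed
  with hom0 show "sublinear (\<lambda>y. INF i\<in>I. \<phi> i y)"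
    by (fold p_def) (auto simp: sublinear_def)
qed

text \<open>The Hahn--Banach theorem in its dominated form. A sublinear functional \<open>m\<close> below \<open>p\<close> that is
  minimal (Zorn) must be linear: for every \<open>x\<close> the functional
  \<open>y \<mapsto> inf {m (y + t x) - t m x | t \<ge> 0}\<close> is again sublinear and lies below \<open>m\<close>, so it equals
  \<open>m\<close>, and its value at \<open>- x\<close> shows \<open>m (- x) \<le> - m x\<close>.\<close>
theorem sublinear_dominates_linear:
  assumes p: "sublinear p"
  shows "\<exists>f. linear f \<and> (\<forall>x. f x \<le> p x)"
proof -
  define A where "A = {q. sublinear q \<and> (\<forall>x. q x \<le> p x)}"
  have "\<exists>m\<in>A. \<forall>q\<in>A. q \<le> m \<longrightarrow> q = m"
  proof (rule predicate_Zorn)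
    show "partial_order_on A (relation_of (\<lambda>a b. b \<le> a) A)"
      by (rule partial_order_on_relation_ofI) auto
    fix C assume C: "C \<in> Chains (relation_of (\<lambda>a b. b \<le> a) A)"
    then have CA: "C \<subseteq> A" and tot: "\<And>a b. a \<in> C \<Longrightarrow> b \<in> C \<Longrightarrow> a \<le> b \<or> b \<le> a"
      unfolding Chains_def relation_of_def by auto
    show "\<exists>u\<in>A. \<forall>a\<in>C. u \<le> a"
    proof (cases "C = {}")
      case True
      then show ?thesis using p by (auto simp: A_def)
    next
      case False
      define u where "u = (\<lambda>x. INF q\<in>C. q x)"
      have bdd: "- p (- y) \<le> q y" if "q \<in> C" for q y
      proof -
        have "sublinear q" "q (- y) \<le> p (- y)" using that CA by (auto simp: A_def)
        then show ?thesis using sublinearD(4)[of q y] by linarith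
      qed
      have add: "\<exists>k\<in>C. k (y + z) \<le> i y + j z" if ij: "i \<in> C" "j \<in> C" for i j y z
      proof -
        obtain k where k: "k \<in> C" "k \<le> i" "k \<le> j" using tot[OF ij] ij by auto
        then have "sublinear k" using CA by (auto simp: A_def)
        then have "k (y + z) \<le> k y + k z" by (rule sublinearD)
        moreover have "k y \<le> i y" "k z \<le> j z" using k by (auto simp: le_fun_def)
        ultimately show ?thesis using k(1) by (intro bexI[of _ k]) auto
      qed
      have scale: "\<exists>j\<in>C. s * j y \<le> i (s *\<^sub>R y)" if "i \<in> C" "s > 0" for i s y
        using that CA sublinearD(2)[of i s y] by (intro bexI[of _ i]) (auto simp: A_def)
      have u: "sublinear u" "\<And>q y. q \<in> C \<Longrightarrow> u y \<le> q y"
        unfolding u_def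
        by (rule sublinear_INF[of C "\<lambda>y. - p (- y)" "\<lambda>q. q"]; use False bdd add scale in blast)+
      obtain q where "q \<in> C" using False by auto
      moreover from this have "q x \<le> p x" for x using CA by (auto simp: A_def)
      ultimately have "u x \<le> p x" for x using u(2) order_trans by blast
      with u show ?thesis by (auto simp: A_def le_fun_def)
    qed
  qed
  then obtain m where m: "m \<in> A" and min: "\<And>q. q \<in> A \<Longrightarrow> q \<le> m \<Longrightarrow> q = m" by blast
  then have sm: "sublinear m" and mp: "\<And>x. m x \<le> p x" by (auto simp: A_def)
  have neg: "m (- x) = - m x" for x
  proof -
    define \<phi> where "\<phi> = (\<lambda>t y. m (y + t *\<^sub>R x) - t * m x)"
    have bdd: "- m (- y) \<le> \<phi> t y" if "t \<in> {0..}" for t y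
    proof -
      have "t * m x = m ((y + t *\<^sub>R x) + (- y))" using sublinearD(2)[OF sm, of t x] that by simp
      also have "\<dots> \<le> m (y + t *\<^sub>R x) + m (- y)" by (rule sublinearD[OF sm])
      finally show ?thesis by (simp add: \<phi>_def)
    qed
    have add: "\<exists>k\<in>{0..}. \<phi> k (y + z) \<le> \<phi> s y + \<phi> t z" if "s \<in> {0..}" "t \<in> {0..}" for s t y z
    proof (rule bexI[of _ "s + t"])
      have "m ((y + s *\<^sub>R x) + (z + t *\<^sub>R x)) \<le> m (y + s *\<^sub>R x) + m (z + t *\<^sub>R x)"
        by (rule sublinearD[OF sm])
      then show "\<phi> (s + t) (y + z) \<le> \<phi> s y + \<phi> t z" by (simp add: \<phi>_def algebra_simps)
    qed (use that in auto)
    have scale: "\<exists>j\<in>{0..}. s * \<phi> j y \<le> \<phi> t (s *\<^sub>R y)" if "t \<in> {0..}" "s > 0" for t s y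
    proof (rule bexI[of _ "t / s"])
      have "s *\<^sub>R (y + (t / s) *\<^sub>R x) = s *\<^sub>R y + t *\<^sub>R x" using that by (simp add: scaleR_add_right)
      then have "m (s *\<^sub>R y + t *\<^sub>R x) = s * m (y + (t / s) *\<^sub>R x)"
        using sublinearD(2)[OF sm, of s "y + (t / s) *\<^sub>R x"] that by simp
      then show "s * \<phi> (t / s) y \<le> \<phi> t (s *\<^sub>R y)" using that by (simp add: \<phi>_def algebra_simps)
    qed (use that in auto)
    define q where "q = (\<lambda>y. INF t\<in>{0..}. \<phi> t y)"
    have q: "sublinear q" "\<And>t y. t \<ge> 0 \<Longrightarrow> q y \<le> \<phi> t y"
      unfolding q_def using sublinear_INF[of "{0..}" "\<lambda>y. - m (- y)" \<phi>, OF _ bdd add scale] by auto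
    have "q y \<le> m y" for y using q(2)[of 0 y] by (simp add: \<phi>_def)
    then have "q = m" using q(1) mp by (intro min) (auto simp: A_def le_fun_def intro: order_trans)
    then have "m (- x) \<le> \<phi> 1 (- x)" using q(2)[of 1 "- x"] by simp
    then have "m (- x) \<le> - m x" using sublinearD(3)[OF sm] by (simp add: \<phi>_def)
    then show ?thesis using sublinearD(4)[OF sm, of x] by linarith
  qed
  have add: "m (x + y) = m x + m y" for x y
    using sublinearD(1)[OF sm, of x y] sublinearD(1)[OF sm, of "x + y" "- y"] neg[of y] by simp
  have "m (t *\<^sub>R x) = t *\<^sub>R m x" for t x
  proof (cases "t \<ge> 0")
    case False
    then have "m ((- t) *\<^sub>R (- x)) = (- t) * m (- x)" by (intro sublinearD[OF sm]) auto
    then show ?thesis by (simp add: neg)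
  qed (simp add: sublinearD(2)[OF sm])
  with add have "linear m" by (auto intro!: linearI)
  with mp show ?thesis by blast
qed

lemma linear_bounded_above_imp_blinfun:
  fixes f :: "'a::real_normed_vector \<Rightarrow> real"
  assumes f: "linear f" and r: "r > 0" and le: "\<And>h. norm h \<le> r \<Longrightarrow> f h \<le> B"
  shows "\<exists>g. \<forall>x. blinfun_apply g x = f x"
proof -
  have "\<bar>f x\<bar> \<le> norm x * (B / r)" for x
  proof (cases "x = 0")
    case False
    define h where "h = (r / norm x) *\<^sub>R x"
    have h: "norm h = r" using False r by (simp add: h_def)
    then have "f h \<le> B" "f (- h) \<le> B" using le[of h] le[of "- h"] by auto
    moreover have "f h = r / norm x * f x" "f (- h) = - (r / norm x * f x)"
      using linear_scale[OF f] linear_neg[OF f] by (auto simp: h_def)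
    ultimately have "\<bar>r / norm x * f x\<bar> \<le> B" by linarith
    then show ?thesis using False r by (simp add: abs_mult field_simps)
  qed (simp add: linear_0[OF f])
  then have "bounded_linear f"
    by (intro bounded_linear_intro[of _ "B / r"]) (auto simp: linear_add[OF f] linear_scale[OF f])
  then show ?thesis by (intro exI[of _ "Blinfun f"]) (simp add: bounded_linear_Blinfun_apply)
qed

text \<open>If \<open>C\<close> has distance at least \<open>d\<close> from \<open>x\<close>, then
  \<open>y \<mapsto> inf {norm (y + t (c - x)) - t d | t \<ge> 0, c \<in> C}\<close> is finite and, by convexity of \<open>C\<close>,
  sublinear. A linear functional below it is bounded by the norm and takes a value of at most
  \<open>- d\<close> at every \<open>x - c\<close>.\<close>
lemma closed_convex_strict_separation:
  fixes C :: "'a::real_normed_vector set"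
  assumes C: "closed C" "convex C" and x: "x \<notin> C"
  shows "\<exists>(f :: 'a \<Rightarrow>\<^sub>L real) d. d > 0 \<and> (\<forall>c\<in>C. blinfun_apply f x + d \<le> blinfun_apply f c)"
proof (cases "C = {}")
  case True
  then show ?thesis by (intro exI[of _ 0] exI[of _ 1]) auto
next
  case ne: False
  obtain d where d: "d > 0" "\<And>c. c \<in> C \<Longrightarrow> d \<le> dist x c"
  proof -
    have "open (- C)" using C(1) by (rule open_Compl)
    then obtain d where "d > 0" "ball x d \<subseteq> - C" using x openE[of "- C" x] by auto
    then show ?thesis using that[of d] by (force simp: subset_iff)
  qed
  define I where "I = {0::real..} \<times> C"
  define \<phi> where "\<phi> = (\<lambda>(t, c) y. norm (y + t *\<^sub>R (c - x)) - t * d)"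
  have "I \<noteq> {}" using ne by (auto simp: I_def)
  have bdd: "- norm y \<le> \<phi> i y" if i: "i \<in> I" for i y
  proof -
    obtain t c where tc: "i = (t, c)" "t \<ge> 0" "c \<in> C" using i by (auto simp: I_def)
    have "t * d \<le> norm (t *\<^sub>R (c - x))"
      using d(2)[OF tc(3)] tc(2) by (simp add: dist_norm norm_minus_commute mult_left_mono)
    also have "\<dots> \<le> norm (y + t *\<^sub>R (c - x)) + norm y"
      using norm_triangle_ineq4[of "y + t *\<^sub>R (c - x)" y] by simp
    finally show ?thesis by (simp add: \<phi>_def tc)
  qed
  have add: "\<exists>k\<in>I. \<phi> k (y + z) \<le> \<phi> i y + \<phi> j z" if ij: "i \<in> I" "j \<in> I" for i j y z
  proof -
    obtain s c t e where *: "i = (s, c)" "s \<ge> 0" "c \<in> C" "j = (t, e)" "t \<ge> 0" "e \<in> C"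
      using ij by (auto simp: I_def)
    obtain k where k: "k \<in> C" "(s + t) *\<^sub>R (k - x) = s *\<^sub>R (c - x) + t *\<^sub>R (e - x)"
    proof (cases "s + t = 0")
      case True
      then have "s = 0" "t = 0" using * by auto
      then show ?thesis using * that[of c] by simp
    next
      case False
      define k where "k = (s / (s + t)) *\<^sub>R c + (t / (s + t)) *\<^sub>R e"
      have "k \<in> C" unfolding k_def
        by (rule convexD[OF C(2)]) (use * False in \<open>auto simp: add_divide_distrib[symmetric]\<close>)
      moreover have "(s + t) *\<^sub>R k = s *\<^sub>R c + t *\<^sub>R e"
        using False by (simp add: k_def scaleR_add_right)
      ultimately show ?thesis using that[of k] by (simp add: algebra_simps)
    qed
    have "norm (y + z + (s + t) *\<^sub>R (k - x)) \<le> norm (y + s *\<^sub>R (c - x)) + norm (z + t *\<^sub>R (e - x))"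
      unfolding k(2) using norm_triangle_ineq[of "y + s *\<^sub>R (c - x)" "z + t *\<^sub>R (e - x)"]
      by (simp add: algebra_simps)
    then show ?thesis using k(1) *
      by (intro bexI[of _ "(s + t, k)"]) (auto simp: I_def \<phi>_def algebra_simps)
  qed
  have scale: "\<exists>j\<in>I. s * \<phi> j y \<le> \<phi> i (s *\<^sub>R y)" if i: "i \<in> I" "s > 0" for i s y
  proof -
    obtain t c where tc: "i = (t, c)" "t \<ge> 0" "c \<in> C" using i by (auto simp: I_def)
    have "s *\<^sub>R (y + (t / s) *\<^sub>R (c - x)) = s *\<^sub>R y + t *\<^sub>R (c - x)"
      using i by (simp add: scaleR_add_right)
    then have "norm (s *\<^sub>R y + t *\<^sub>R (c - x)) = s * norm (y + (t / s) *\<^sub>R (c - x))"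
      using i by (metis abs_of_pos norm_scaleR)
    then show ?thesis using i tc
      by (intro bexI[of _ "(t / s, c)"]) (auto simp: I_def \<phi>_def right_diff_distrib)
  qed
  define p where "p = (\<lambda>y. INF i\<in>I. \<phi> i y)"
  have p: "sublinear p" "\<And>i y. i \<in> I \<Longrightarrow> p y \<le> \<phi> i y"
    unfolding p_def
    using sublinear_INF[of I "\<lambda>y. - norm y" \<phi>, OF \<open>I \<noteq> {}\<close> bdd add scale] by auto
  obtain f where f: "linear f" "\<And>y. f y \<le> p y" using sublinear_dominates_linear[OF p(1)] by blast
  obtain c0 where "c0 \<in> C" using ne by auto
  then have "f y \<le> norm y" for y using f(2)[of y] p(2)[of "(0, c0)" y] by (simp add: I_def \<phi>_def)
  then obtain g where g: "\<And>y. blinfun_apply g y = f y"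
    using linear_bounded_above_imp_blinfun[OF f(1), of 1 1] by (metis order_trans zero_less_one)
  have "f x + d \<le> f c" if "c \<in> C" for c
  proof -
    have "f (x - c) \<le> \<phi> (1, c) (x - c)" using f(2)[of "x - c"] p(2)[of "(1, c)" "x - c"] that
      by (simp add: I_def)
    then show ?thesis by (simp add: \<phi>_def linear_diff[OF f(1)])
  qed
  with d(1) g show ?thesis by (intro exI[of _ g] exI[of _ d]) auto
qed

text \<open>The one-sided directional derivative of \<open>f\<close> at \<open>u\<close>, an infimum of difference quotients, is
  sublinear. Linear functionals below it are exactly the algebraic subgradients, and the local
  upper bound makes them continuous.\<close>
lemma subgradient_exists_of_bounded_above:
  fixes f :: "'a::real_normed_vector \<Rightarrow> real"
  assumes conv: "convex_on UNIV f" and r: "r > 0" and B: "\<And>h. norm h \<le> r \<Longrightarrow> f (u + h) \<le> B"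
  shows "subdifferential f u \<noteq> {}"
proof -
  define \<phi> where "\<phi> = (\<lambda>t h. (f (u + t *\<^sub>R h) - f u) / t)"
  have comb: "f (a *\<^sub>R x + c *\<^sub>R y) \<le> a * f x + c * f y" if "a \<ge> 0" "c \<ge> 0" "a + c = 1" for a c x y
    using conv that by (auto simp: convex_on_def)
  have bdd: "f u - f (u - h) \<le> \<phi> t h" if "t \<in> {0<..}" for t h
  proof -
    have t: "t > 0" using that by simp
    have eq: "(1 / (1 + t)) *\<^sub>R (u + t *\<^sub>R h) + (t / (1 + t)) *\<^sub>R (u - h)
        = (1 / (1 + t) + t / (1 + t)) *\<^sub>R u" by (simp add: algebra_simps)
    have one: "1 / (1 + t) + t / (1 + t) = 1" using t by (simp add: field_simps)
    have "f u \<le> (1 / (1 + t)) * f (u + t *\<^sub>R h) + (t / (1 + t)) * f (u - h)"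
      using comb[of "1 / (1 + t)" "t / (1 + t)" "u + t *\<^sub>R h" "u - h"] t unfolding eq one by simp
    also have "\<dots> = (f (u + t *\<^sub>R h) + t * f (u - h)) / (1 + t)" by (simp add: add_divide_distrib)
    finally have "f u * (1 + t) \<le> f (u + t *\<^sub>R h) + t * f (u - h)"
      using t by (simp add: pos_le_divide_eq)
    then show ?thesis unfolding \<phi>_def pos_le_divide_eq[OF t] by (simp add: algebra_simps)
  qed
  have add: "\<exists>k\<in>{0<..}. \<phi> k (y + z) \<le> \<phi> s y + \<phi> t z" if "s \<in> {0<..}" "t \<in> {0<..}" for s t y z
  proof (rule bexI)
    have st: "s > 0" "t > 0" using that by auto
    define k where "k = s * t / (s + t)"
    have k: "k > 0" using st by (simp add: k_def)
    \<comment> \<open>The step size for which \<open>u + k (y + z)\<close> is a convex combination of \<open>u + s y\<close> and \<open>u + t z\<close>.\<close>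
    show "s * t / (s + t) \<in> {0<..}" using st by simp
    have one: "t / (s + t) + s / (s + t) = 1" using st by (simp add: add_divide_distrib[symmetric])
    have eq: "(t / (s + t)) *\<^sub>R (u + s *\<^sub>R y) + (s / (s + t)) *\<^sub>R (u + t *\<^sub>R z)
        = (t / (s + t) + s / (s + t)) *\<^sub>R u + k *\<^sub>R (y + z)"
      by (simp add: k_def algebra_simps)
    have "f (u + k *\<^sub>R (y + z)) \<le> t / (s + t) * f (u + s *\<^sub>R y) + s / (s + t) * f (u + t *\<^sub>R z)"
      using comb[of "t / (s + t)" "s / (s + t)" "u + s *\<^sub>R y" "u + t *\<^sub>R z"] st one
      unfolding eq by simp
    also have "\<dots> = k * (\<phi> s y + \<phi> t z) + (t / (s + t) + s / (s + t)) * f u"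
    proof -
      have s1: "k * (\<phi> s y) = t / (s + t) * (f (u + s *\<^sub>R y) - f u)"
        using st by (simp add: k_def \<phi>_def)
      have s2: "k * (\<phi> t z) = s / (s + t) * (f (u + t *\<^sub>R z) - f u)"
        using st by (simp add: k_def \<phi>_def)
      show ?thesis unfolding distrib_left[of k] s1 s2 by (simp add: algebra_simps)
    qed
    finally have "f (u + k *\<^sub>R (y + z)) - f u \<le> k * (\<phi> s y + \<phi> t z)" unfolding one by simp
    then have "(f (u + k *\<^sub>R (y + z)) - f u) / k \<le> \<phi> s y + \<phi> t z"
      using k by (simp add: pos_divide_le_eq mult.commute)
    then show "\<phi> (s * t / (s + t)) (y + z) \<le> \<phi> s y + \<phi> t z"
      by (subst \<phi>_def) (simp add: k_def)
  qed
  have scale: "\<exists>j\<in>{0<..}. s * \<phi> j y \<le> \<phi> t (s *\<^sub>R y)" if "t \<in> {0<..}" "s > 0" for t s y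
    by (rule bexI[of _ "t * s"]) (use that in \<open>auto simp: \<phi>_def\<close>)
  define p where "p = (\<lambda>y. INF t\<in>{0<..}. \<phi> t y)"
  have p: "sublinear p" "\<And>t y. t > 0 \<Longrightarrow> p y \<le> \<phi> t y"
    unfolding p_def
    using sublinear_INF[of "{0<..}" "\<lambda>h. f u - f (u - h)" \<phi>, OF _ bdd add scale] by auto
  obtain g where g: "linear g" "\<And>y. g y \<le> p y" using sublinear_dominates_linear[OF p(1)] by blast
  have gf: "g h \<le> f (u + h) - f u" for h using g(2)[of h] p(2)[of 1 h] by (simp add: \<phi>_def)
  then have "g h \<le> B - f u" if "norm h \<le> r" for h using B[OF that] by (smt (verit))
  then obtain G where "\<And>y. blinfun_apply G y = g y"
    using linear_bounded_above_imp_blinfun[OF g(1) r] by metis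
  then have "G \<in> subdifferential f u" using gf[of "v - u" for v]
    by (auto simp: subdifferential_def algebra_simps)
  then show ?thesis by blast
qed

text \<open>A finite lower semicontinuous convex function on a Banach space is bounded above near every
  point: by Baire's theorem one of its closed sublevel sets contains a ball, and convexity
  carries the bound from there to any other point.\<close>
theorem subdifferential_nonempty_lsc:
  fixes f :: "'a::banach \<Rightarrow> real"
  assumes conv: "convex_on UNIV f" and lsc: "lower_semicontinuous f"
  shows "subdifferential f u \<noteq> {}"
proof -
  have comb: "f (a *\<^sub>R x + c *\<^sub>R y) \<le> a * f x + c * f y" if "a \<ge> 0" "c \<ge> 0" "a + c = 1" for a c x y
    using conv that by (auto simp: convex_on_def)
  define S where "S = (\<lambda>n::nat. {x. f x \<le> real n})"
  have "closed (S n)" for n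
  proof -
    have "open {x. real n < f x}"
      unfolding open_subopen[of "{x. real n < f x}"]
      using lsc by (fastforce simp: lower_semicontinuous_def eventually_nhds)
    moreover have "S n = - {x. real n < f x}" by (auto simp: S_def)
    ultimately show ?thesis by (metis closed_Compl)
  qed
  have "\<exists>n. interior (S n) \<noteq> {}"
  proof (rule ccontr)
    assume "\<not> ?thesis"
    then have "euclidean interior_of (\<Union>(range S)) = {}"
      using \<open>\<And>n. closed (S n)\<close>
      by (intro Baire_category_alt) (auto simp: completely_metrizable_space_euclidean)
    moreover have "(\<Union>(range S)) = UNIV" using real_arch_simple by (auto simp: S_def)
    ultimately show False by simp
  qed
  then obtain n x0 where "x0 \<in> interior (S n)" by blast
  then obtain r where r: "r > 0" "cball x0 r \<subseteq> S n" by (meson mem_interior_cball)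
  \<comment> \<open>\<open>u\<close> lies strictly between the centre of this ball and the reflected point \<open>y\<close>, so a
    neighbourhood of \<open>u\<close> lies in the convex hull of the ball and \<open>y\<close>.\<close>
  define y where "y = 2 *\<^sub>R u - x0"
  show ?thesis
  proof (rule subgradient_exists_of_bounded_above[OF conv, of "r / 2"])
    fix h :: 'a assume h: "norm h \<le> r / 2"
    have "x0 + 2 *\<^sub>R h \<in> S n" using h r by (intro subsetD[OF r(2)]) (simp add: dist_norm)
    then have "f (x0 + 2 *\<^sub>R h) \<le> n" by (simp add: S_def)
    moreover have "u + h = (1/2) *\<^sub>R (x0 + 2 *\<^sub>R h) + (1/2) *\<^sub>R y"
      by (simp add: y_def algebra_simps)
    ultimately show "f (u + h) \<le> 1/2 * n + 1/2 * f y"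
      using comb[of "1/2" "1/2" "x0 + 2 *\<^sub>R h" y] by simp
  qed (use r in simp)
qed

text \<open>Evaluations of the dual at a bounded family stay in a product of compact intervals. By
  Tychonoff's theorem they have a cluster point, which is a bounded linear functional on the
  dual, hence by reflexivity the evaluation at a point of the space. A filter finer than \<open>F\<close>
  takes the place of a subsequence.\<close>
lemma weak_cluster_point:
  fixes X :: "'i \<Rightarrow> 'u::real_normed_vector"
  assumes refl: "reflexive_space TYPE('u)" and F: "F \<noteq> bot"
    and bdd: "eventually (\<lambda>i. norm (X i) \<le> C) F"
  shows "\<exists>F' x. F' \<noteq> bot \<and> F' \<le> F \<and> limitin weak_topology X x F'"
proof -
  define e where "e = (\<lambda>i (f :: 'u \<Rightarrow>\<^sub>L real). blinfun_apply f (X i))"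
  define S where "S = (PiE UNIV (\<lambda>f :: 'u \<Rightarrow>\<^sub>L real. {- (C * norm f)..C * norm f}))"
  have "compactin (product_topology (\<lambda>_. euclidean) UNIV) S"
    unfolding S_def compactin_PiE by auto
  then have "compact S" by (simp add: euclidean_product_topology)
  moreover have "filtermap e F \<noteq> bot" using F by (simp add: filtermap_bot_iff)
  moreover have "eventually (\<lambda>y. y \<in> S) (filtermap e F)"
    unfolding eventually_filtermap using bdd
  proof eventually_elim
    case (elim i)
    have "\<bar>blinfun_apply f (X i)\<bar> \<le> C * norm f" for f :: "'u \<Rightarrow>\<^sub>L real"
      using norm_blinfun[of f "X i"] mult_left_mono[OF elim, of "norm f"]
      by (simp add: mult.commute)
    then show ?case by (simp add: e_def S_def PiE_UNIV_domain abs_le_iff minus_le_iff)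
  qed
  ultimately obtain g where g: "g \<in> S" "inf (nhds g) (filtermap e F) \<noteq> bot"
    using compact_filter[of S, THEN iffD1, rule_format, of "filtermap e F"] by blast
  \<comment> \<open>The coarsest filter below \<open>F\<close> along which the evaluations converge to \<open>g\<close>.\<close>
  define F' where "F' = inf F (filtercomap e (nhds g))"
  have "F' \<noteq> bot"
  proof
    assume "F' = bot"
    then obtain P Q where PQ: "eventually P F" "eventually Q (nhds g)" "\<And>i. P i \<Longrightarrow> \<not> Q (e i)"
      unfolding F'_def trivial_limit_def eventually_inf eventually_filtercomap by blast
    then have "eventually (\<lambda>y. \<not> Q y) (filtermap e F)"
      unfolding eventually_filtermap by (auto elim: eventually_mono)
    then have "eventually (\<lambda>y. False) (inf (nhds g) (filtermap e F))"
      using PQ(2) unfolding eventually_inf by blast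
    then show False using g(2) by (simp add: trivial_limit_def)
  qed
  have "filterlim e (nhds g) F'"
    unfolding filterlim_iff_le_filtercomap F'_def by simp
  then have lim: "((\<lambda>i. blinfun_apply f (X i)) \<longlongrightarrow> g f) F'" for f
    using limitin_componentwise[of "\<lambda>_ :: 'u \<Rightarrow>\<^sub>L real. euclidean :: real topology" UNIV e g F']
    by (simp add: euclidean_product_topology e_def)
  have "bounded_linear g"
  proof (rule bounded_linear_intro[of _ C])
    fix a b :: "'u \<Rightarrow>\<^sub>L real" and t :: real
    show "g (a + b) = g a + g b"
      by (rule tendsto_unique[OF \<open>F' \<noteq> bot\<close> lim])
        (use tendsto_add[OF lim[of a] lim[of b]] in \<open>simp add: plus_blinfun.rep_eq\<close>)
    show "g (t *\<^sub>R a) = t *\<^sub>R g a"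
      by (rule tendsto_unique[OF \<open>F' \<noteq> bot\<close> lim])
        (use tendsto_scaleR[OF tendsto_const lim[of a]] in \<open>simp add: scaleR_blinfun.rep_eq\<close>)
    have "g a \<in> {- (C * norm a)..C * norm a}" using g(1) by (auto simp: S_def)
    then show "norm (g a) \<le> norm a * C" by (simp add: abs_le_iff minus_le_iff mult.commute)
  qed
  then obtain x where "\<And>f. g f = blinfun_apply f x"
    using refl unfolding reflexive_space_def by (metis bounded_linear_Blinfun_apply)
  then have "limitin weak_topology X x F'" using lim by (simp add: limitin_weak_topology)
  with \<open>F' \<noteq> bot\<close> show ?thesis by (auto simp: F'_def)
qed

text \<open>Mazur's theorem: a functional that separates the limit from the set would also separate it from
  the family.\<close>
lemma weak_limit_in_closed_convex:
  fixes X :: "'i \<Rightarrow> 'u::real_normed_vector"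
  assumes S: "closed S" "convex S" and F: "F \<noteq> bot"
    and ev: "eventually (\<lambda>i. X i \<in> S) F" and lim: "limitin weak_topology X x F"
  shows "x \<in> S"
proof (rule ccontr)
  assume "x \<notin> S"
  then obtain f :: "'u \<Rightarrow>\<^sub>L real" and d where fd: "d > 0"
      "\<And>c. c \<in> S \<Longrightarrow> blinfun_apply f x + d \<le> blinfun_apply f c"
    using closed_convex_strict_separation[OF S] by blast
  have "((\<lambda>i. blinfun_apply f (X i)) \<longlongrightarrow> blinfun_apply f x) F"
    using lim by (simp add: limitin_weak_topology)
  moreover have "eventually (\<lambda>i. blinfun_apply f x + d \<le> blinfun_apply f (X i)) F"
    using ev by eventually_elim (rule fd(2))
  ultimately have "blinfun_apply f x + d \<le> blinfun_apply f x"
    using F tendsto_lowerbound by blast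
  with fd(1) show False by simp
qed

text \<open>If convergence failed, the indices that stay away from \<open>u\<close> under some functional would carry a
  finer filter, and along it a cluster point different from \<open>u\<close>.\<close>
lemma weakly_convergent_of_unique_cluster_point:
  fixes X :: "'i \<Rightarrow> 'u::real_normed_vector"
  assumes refl: "reflexive_space TYPE('u)" and bdd: "eventually (\<lambda>i. norm (X i) \<le> C) F"
    and uniq: "\<And>G x. G \<noteq> bot \<Longrightarrow> G \<le> F \<Longrightarrow> limitin weak_topology X x G \<Longrightarrow> x = u"
  shows "limitin weak_topology X u F"
  unfolding limitin_weak_topology
proof (rule allI, rule tendstoI, rule ccontr)
  fix f :: "'u \<Rightarrow>\<^sub>L real" and e :: real
  assume e: "e > 0" and "\<not> eventually (\<lambda>i. dist (blinfun_apply f (X i)) (blinfun_apply f u) < e) F"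
  define F0 where "F0 = inf F (principal {i. e \<le> dist (blinfun_apply f (X i)) (blinfun_apply f u)})"
  have "F0 \<noteq> bot"
    using \<open>\<not> eventually _ F\<close> unfolding F0_def trivial_limit_def eventually_inf_principal
    by (simp add: not_le)
  moreover have "eventually (\<lambda>i. norm (X i) \<le> C) F0"
    unfolding F0_def by (rule filter_leD[OF inf_le1 bdd])
  ultimately obtain G x where G: "G \<noteq> bot" "G \<le> F0" "limitin weak_topology X x G"
    using weak_cluster_point[OF refl] by blast
  then have "x = u" using uniq by (metis F0_def le_infE)
  then have "((\<lambda>i. blinfun_apply f (X i)) \<longlongrightarrow> blinfun_apply f u) G"
    using G(3) by (simp add: limitin_weak_topology)
  then have "eventually (\<lambda>i. dist (blinfun_apply f (X i)) (blinfun_apply f u) < e) G"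
    using e tendstoD by blast
  moreover have "eventually (\<lambda>i. e \<le> dist (blinfun_apply f (X i)) (blinfun_apply f u)) G"
    by (rule filter_leD[OF G(2)]) (simp add: F0_def eventually_inf_principal)
  ultimately have "eventually (\<lambda>i. False) G" by eventually_elim simp
  with G(1) show False by (simp add: trivial_limit_def)
qed

lemma sublevel_closed_convex:
  fixes J :: "'u::real_normed_vector \<Rightarrow> real"
  assumes "closed S" "convex_on S J" "continuous_on S J"
  shows "closed {u\<in>S. J u \<le> c}" "convex {u\<in>S. J u \<le> c}"
proof -
  have "closed (S \<inter> J -` {..c})"
    by (rule continuous_closed_preimage[OF assms(3,1)]) simp
  also have "S \<inter> J -` {..c} = {u\<in>S. J u \<le> c}" by auto
  finally show "closed {u\<in>S. J u \<le> c}" .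
  show "convex {u\<in>S. J u \<le> c}"
  proof (rule convexI)
    fix x y and s t :: real
    assume *: "x \<in> {u\<in>S. J u \<le> c}" "y \<in> {u\<in>S. J u \<le> c}" "0 \<le> s" "0 \<le> t" "s + t = 1"
    then have "J (s *\<^sub>R x + t *\<^sub>R y) \<le> s * J x + t * J y"
      using assms(2) by (auto simp: convex_on_def)
    also have "\<dots> \<le> s * c + t * c" using * by (intro add_mono mult_left_mono) auto
    finally have "J (s *\<^sub>R x + t *\<^sub>R y) \<le> c" using * by (metis distrib_right mult_1)
    moreover have "s *\<^sub>R x + t *\<^sub>R y \<in> S"
      using assms(2) * by (auto simp: convex_on_def intro: convexD)
    ultimately show "s *\<^sub>R x + t *\<^sub>R y \<in> {u\<in>S. J u \<le> c}" by simp
  qed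
qed

text \<open>The sublevel sets at the values of \<open>J\<close> generate a filter. By coercivity it is bounded, and by
  Mazur's theorem a weak cluster point of it belongs to all these sublevel sets at once.\<close>
lemma convex_coercive_attains_min:
  fixes J :: "'u::real_normed_vector \<Rightarrow> real"
  assumes refl: "reflexive_space TYPE('u)"
    and S: "S \<noteq> {}" "closed S" and J: "convex_on S J" "continuous_on S J" "coercive_on S J"
  shows "\<exists>u. is_arg_min J (\<lambda>v. v \<in> S) u"
proof -
  define L where "L = (\<lambda>s. {u\<in>S. J u \<le> J s})"
  define F where "F = (INF s\<in>S. principal (L s))"
  have "F \<noteq> bot"
  proof -
    have "(F = bot) = (\<exists>s\<in>S. principal (L s) = bot)" unfolding F_def
    proof (rule INF_filter_bot_base)
      fix i j assume "i \<in> S" "j \<in> S"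
      then show "\<exists>k\<in>S. principal (L k) \<le> inf (principal (L i)) (principal (L j))"
        by (intro bexI[of _ "if J i \<le> J j then i else j"]) (auto simp: L_def)
    qed
    moreover have "s \<in> L s" if "s \<in> S" for s using that by (simp add: L_def)
    ultimately show ?thesis by (auto simp: principal_eq_bot_iff)
  qed
  have evL: "eventually (\<lambda>u. u \<in> L s) F" if "s \<in> S" for s
    unfolding F_def by (rule eventually_INF1[OF that]) (simp add: eventually_principal)
  obtain s0 where s0: "s0 \<in> S" using S by blast
  have "eventually (\<lambda>u. J s0 < J u) (inf at_infinity (principal S))"
    using J(3) unfolding coercive_on_def filterlim_at_top_dense by blast
  then obtain C where C: "\<And>u. C \<le> norm u \<Longrightarrow> u \<in> S \<Longrightarrow> J s0 < J u"
    unfolding eventually_inf_principal eventually_at_infinity by blast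
  have "eventually (\<lambda>u. norm u \<le> C) F"
    using evL[OF s0]
  proof eventually_elim
    case (elim u)
    then show ?case using C[of u] by (force simp: L_def)
  qed
  then obtain G x where G: "G \<noteq> bot" "G \<le> F" "limitin weak_topology (\<lambda>u. u) x G"
    using weak_cluster_point[OF refl \<open>F \<noteq> bot\<close>, of "\<lambda>u. u" C] by blast
  have "x \<in> L s" if "s \<in> S" for s
    by (rule weak_limit_in_closed_convex[OF _ _ G(1) filter_leD[OF G(2) evL[OF that]] G(3)])
      (use sublevel_closed_convex[OF S(2) J(1,2)] in \<open>auto simp: L_def\<close>)
  then have "is_arg_min J (\<lambda>v. v \<in> S) x" using s0 by (force simp: is_arg_min_linorder L_def)
  then show ?thesis by blast
qed

section \<open>Real recursions with summable perturbations\<close>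

text \<open>Subtracting the partial sums of \<open>c\<close> makes \<open>L\<close> decreasing. The perturbation \<open>c\<close> may change sign,
  and its series may converge only conditionally, as is the case for the martingale noise below.\<close>
lemma quasi_decreasing_convergent:
  fixes L c v :: "nat \<Rightarrow> real"
  assumes step: "\<And>k. L (Suc k) \<le> L k + c k - v k" and v: "\<And>k. v k \<ge> 0"
    and c: "summable c" and lower: "\<And>k. l \<le> L k"
  shows "convergent L" "summable v"
proof -
  define T where "T = (\<lambda>k. L k - (\<Sum>i<k. c i))"
  have T: "T (Suc k) \<le> T k - v k" for k using step[of k] by (simp add: T_def)
  then have "T (Suc k) \<le> T k" for k using v[of k] by (smt (verit))
  then have "decseq T" by (rule decseq_SucI)
  have sums: "(\<lambda>k. \<Sum>i<k. c i) \<longlonglongrightarrow> suminf c" using c summable_LIMSEQ by blast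
  then obtain B where B: "\<And>k. \<bar>\<Sum>i<k. c i\<bar> \<le> B"
    using convergent_imp_Bseq[OF convergentI] by (force simp: Bseq_def)
  have lowT: "l - B \<le> T k" for k using lower[of k] B[of k] by (simp add: T_def)
  then obtain t where "T \<longlonglongrightarrow> t" using decseq_convergent[OF \<open>decseq T\<close>, of "l - B"] by blast
  then have "(\<lambda>k. T k + (\<Sum>i<k. c i)) \<longlonglongrightarrow> t + suminf c" using sums by (rule tendsto_add)
  then show "convergent L" by (auto simp: T_def convergent_def)
  have "(\<Sum>i<n. v i) \<le> T 0 - T n" for n
  proof (induction n)
    case (Suc n)
    then show ?case using T[of n] by simp
  qed simp
  then have "(\<Sum>i<n. v i) \<le> T 0 - (l - B)" for n using lowT[of n] by (smt (verit))
  then show "summable v" by (intro summableI_nonneg_bounded[of v]) (auto simp: v)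
qed

text \<open>Passing to \<open>ln E\<close> turns the recursion into an additive one. Since \<open>ln x \<le> x - 1\<close>, the
  perturbation enters linearly, so conditional convergence of its series suffices, whereas the
  convergence of the product of the factors \<open>1 + c k\<close> would also require square summability of
  \<open>c\<close>.\<close>
lemma multiplicative_quasi_decreasing_convergent:
  fixes E c v :: "nat \<Rightarrow> real"
  assumes step: "\<And>k. E (Suc k) \<le> (1 + c k) * E k - v k" and v: "\<And>k. v k \<ge> 0"
    and c: "summable c" and E: "\<And>k. 1 \<le> E k"
  shows "convergent E" "summable v"
proof -
  have pos: "E k > 0" for k using E[of k] by simp
  have ln_step: "ln (E (Suc k)) \<le> ln (E k) + c k - v k / E k" for k
  proof -
    have "ln (E (Suc k)) - ln (E k) = ln (E (Suc k) / E k)"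
      using pos[of k] pos[of "Suc k"] by (simp add: ln_div)
    also have "\<dots> \<le> E (Suc k) / E k - 1" using pos by (intro ln_le_minus_one) simp
    also have "\<dots> \<le> ((1 + c k) * E k - v k) / E k - 1"
      using step[of k] pos[of k] by (simp add: divide_right_mono)
    also have "\<dots> = c k - v k / E k" using pos[of k] by (simp add: field_simps)
    finally show ?thesis by simp
  qed
  have *: "convergent (\<lambda>k. ln (E k))" "summable (\<lambda>k. v k / E k)"
    using quasi_decreasing_convergent[of "\<lambda>k. ln (E k)" c "\<lambda>k. v k / E k" 0] ln_step v c E pos
    by (auto simp: less_imp_le)
  then obtain l where "(\<lambda>k. ln (E k)) \<longlonglongrightarrow> l" by (auto simp: convergent_def)
  then have "(\<lambda>k. exp (ln (E k))) \<longlonglongrightarrow> exp l" by (intro tendsto_intros)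
  then have "E \<longlonglongrightarrow> exp l" using pos by simp
  then show "convergent E" by (auto simp: convergent_def)
  then obtain B where B: "\<And>k. \<bar>E k\<bar> \<le> B"
    using convergent_imp_Bseq[of E] by (force simp: Bseq_def)
  show "summable v"
  proof (rule summable_comparison_test')
    show "summable (\<lambda>k. B * (v k / E k))" using *(2) by (rule summable_mult)
    show "norm (v k) \<le> B * (v k / E k)" for k
    proof -
      have "v k = E k * (v k / E k)" using pos[of k] by simp
      also have "\<dots> \<le> B * (v k / E k)"
        using B[of k] v[of k] pos[of k] by (intro mult_right_mono) auto
      finally show ?thesis using v[of k] by simp
    qed
  qed
qed

text \<open>Squaring the slow growth condition gives increments of \<open>v^2\<close> bounded by a multiple of
  \<open>\<epsilon> k * v k + (\<epsilon> k)^2\<close>, which is summable. So \<open>v^2\<close> converges, and a positive limit would make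
  the sum of \<open>\<epsilon>\<close> finite.\<close>
lemma tendsto_0_of_weighted_summable:
  fixes \<epsilon> v :: "nat \<Rightarrow> real"
  assumes pos: "\<And>k. \<epsilon> k > 0" and div: "filterlim (\<lambda>n. \<Sum>k<n. \<epsilon> k) at_top sequentially"
    and sq: "summable (\<lambda>k. (\<epsilon> k)\<^sup>2)" and v: "\<And>k. v k \<ge> 0"
    and sum: "summable (\<lambda>k. \<epsilon> k * v k)" and slow: "\<And>k. v (Suc k) \<le> v k + C * \<epsilon> k"
  shows "v \<longlonglongrightarrow> 0"
proof -
  have "(v (Suc k))\<^sup>2 \<le> (v k)\<^sup>2 + (2 * C * (\<epsilon> k * v k) + C\<^sup>2 * (\<epsilon> k)\<^sup>2) - 0" for k
  proof -
    have "(v (Suc k))\<^sup>2 \<le> (v k + C * \<epsilon> k)\<^sup>2" using slow v by (intro power_mono)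
    then show ?thesis by (simp add: power2_sum power_mult_distrib algebra_simps)
  qed
  then have "convergent (\<lambda>k. (v k)\<^sup>2)"
    by (rule quasi_decreasing_convergent(1)[where l = 0])
      (auto intro!: summable_add summable_mult sum sq)
  then obtain l where l: "(\<lambda>k. (v k)\<^sup>2) \<longlonglongrightarrow> l" by (auto simp: convergent_def)
  then have lim: "v \<longlonglongrightarrow> sqrt l" using tendsto_real_sqrt[OF l] v by simp
  have "sqrt l \<le> 0"
  proof (rule ccontr)
    assume "\<not> sqrt l \<le> 0"
    define s where "s = sqrt l / 2"
    have s: "s > 0" "s < sqrt l" using \<open>\<not> sqrt l \<le> 0\<close> by (auto simp: s_def)
    have "eventually (\<lambda>k. s < v k) sequentially" using order_tendstoD(1)[OF lim s(2)] .
    then have "eventually (\<lambda>k. norm (\<epsilon> k) \<le> (\<epsilon> k * v k) / s) sequentially"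
    proof eventually_elim
      case (elim k)
      then have "\<epsilon> k * s \<le> \<epsilon> k * v k" using pos[of k] by simp
      then show ?case using pos[of k] s by (simp add: pos_le_divide_eq)
    qed
    then have "summable \<epsilon>"
      by (rule summable_comparison_test_ev) (rule summable_divide[OF sum])
    then have "(\<lambda>n. \<Sum>k<n. \<epsilon> k) \<longlonglongrightarrow> suminf \<epsilon>" by (rule summable_LIMSEQ)
    moreover have "filterlim (\<lambda>n. \<Sum>k<n. \<epsilon> k) at_infinity sequentially"
      by (rule filterlim_at_top_imp_at_infinity[OF div])
    ultimately show False
      using not_tendsto_and_filterlim_at_infinity[OF trivial_limit_sequentially] by blast
  qed
  moreover have "sqrt l \<ge> 0" using lim v by (meson LIMSEQ_le_const)
  ultimately show ?thesis using lim by simp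
qed

section \<open>Histories, orthogonal noise and conditional expectations\<close>

text \<open>Open sets of a product are unions of rectangles, in general uncountably many. A countable base
  in the first factor is enough to make the union countable: to every basic set \<open>b\<close> one takes
  the largest open \<open>V b\<close> such that the rectangle \<open>b \<times> V b\<close> is contained in the given open set.\<close>
lemma lower_semicontinuous_pair_measurable:
  fixes f :: "'u::second_countable_topology \<times> 'w::topological_space \<Rightarrow> real"
  assumes "lower_semicontinuous f"
  shows "f \<in> borel_measurable (borel \<Otimes>\<^sub>M borel)"
proof (rule borel_measurable_iff_greater[THEN iffD2, rule_format])
  fix a
  define S where "S = {x. a < f x}"
  have "open S"
    unfolding open_subopen[of S]
    using assms by (fastforce simp: S_def lower_semicontinuous_def eventually_nhds)
  obtain B :: "'u set set" where B: "countable B" "topological_basis B"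
    using ex_countable_basis by blast
  define V where "V = (\<lambda>b. \<Union>{A :: 'w set. open A \<and> b \<times> A \<subseteq> S})"
  have "S \<subseteq> (\<Union>b\<in>B. b \<times> V b)"
  proof
    fix z assume "z \<in> S"
    then obtain A D where AD: "open A" "open D" "z \<in> A \<times> D" "A \<times> D \<subseteq> S"
      using \<open>open S\<close> open_prod_elim by blast
    then obtain b where "b \<in> B" "fst z \<in> b" "b \<subseteq> A"
      using topological_basisE[OF B(2) AD(1)] by (metis mem_Times_iff)
    moreover have "snd z \<in> V b" using AD \<open>b \<subseteq> A\<close> by (auto simp: V_def intro!: exI[of _ D])
    ultimately show "z \<in> (\<Union>b\<in>B. b \<times> V b)" by (auto simp: mem_Times_iff)
  qed
  then have "S = (\<Union>b\<in>B. b \<times> V b)" by (auto simp: V_def)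
  also have "\<dots> \<in> sets (borel \<Otimes>\<^sub>M borel)"
  proof (rule sets.countable_UN''[OF B(1)])
    fix b assume "b \<in> B"
    then have "open b" using B(2) topological_basis_open by blast
    moreover have "open (V b)" by (auto simp: V_def)
    ultimately show "b \<times> V b \<in> sets (borel \<Otimes>\<^sub>M borel)" by (intro pair_measureI) auto
  qed
  finally show "{w \<in> space (borel \<Otimes>\<^sub>M borel). a < f w} \<in> sets (borel \<Otimes>\<^sub>M borel)"
    by (simp add: S_def space_pair_measure)
qed

lemma measurable_larger_sigma_algebra:
  assumes "space F = space G" "sets F \<subseteq> sets G" "f \<in> measurable F N"
  shows "f \<in> measurable G N"
  using assms by (auto simp: measurable_def)

lemma space_history [simp]: "space (history M Ws k) = space M"
  by (simp add: history_def space_measure_of_conv)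

lemma sets_history:
  "sets (history M Ws k) =
     sigma_sets (space M) (\<Union>i\<in>{1..k}. {Ws i -` B \<inter> space M | B. B \<in> sets borel})"
  unfolding history_def by (rule sets_measure_of) auto

lemma sets_history_mono: "k \<le> l \<Longrightarrow> sets (history M Ws k) \<subseteq> sets (history M Ws l)"
  unfolding sets_history by (rule sigma_sets_mono') (use atLeastatMost_subset_iff in blast)

lemma measurable_history_mono:
  assumes "k \<le> l" "f \<in> measurable (history M Ws k) N"
  shows "f \<in> measurable (history M Ws l) N"
  using measurable_larger_sigma_algebra[OF _ sets_history_mono[OF assms(1)] assms(2)] by simp

lemma history_observation_measurable:
  assumes "1 \<le> i" "i \<le> k"
  shows "Ws i \<in> borel_measurable (history M Ws k)"
proof (rule measurableI)
  fix B :: "'b set" assume "B \<in> sets borel"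
  then have "Ws i -` B \<inter> space M \<in> (\<Union>i\<in>{1..k}. {Ws i -` B \<inter> space M | B. B \<in> sets borel})"
    using assms by (intro UN_I[of i]) auto
  then show "Ws i -` B \<inter> space (history M Ws k) \<in> sets (history M Ws k)"
    by (simp add: sets_history sigma_sets.Basic)
qed simp

lemma subalgebra_history:
  assumes "\<And>i. 1 \<le> i \<Longrightarrow> Ws i \<in> borel_measurable M"
  shows "subalgebra M (history M Ws k)"
  unfolding subalgebra_def sets_history
  by (auto intro!: sets.sigma_sets_subset measurable_sets[OF assms])

text \<open>Grouping the independent observations into those up to index \<open>k\<close> and the next one.\<close>
lemma (in prob_space) prob_history_next_observation:
  fixes Ws :: "nat \<Rightarrow> 'a \<Rightarrow> 'w::topological_space"
  assumes ind: "indep_vars (\<lambda>_. borel) Ws {1..}"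
    and A: "A \<in> sets (history M Ws k)" and B: "B \<in> sets borel"
  shows "prob (A \<inter> (Ws (Suc k) -` B \<inter> space M)) = prob A * prob (Ws (Suc k) -` B \<inter> space M)"
proof -
  define E where "E = (\<lambda>i. {Ws i -` B \<inter> space M | B. B \<in> sets (borel :: 'w measure)})"
  have "indep_sets E {1..}" using ind by (simp add: indep_vars_def2 E_def)
  then have "indep_sets E (\<Union>j\<in>UNIV. case_bool {1..k} {Suc k} j)"
    by (rule indep_sets_mono_index[rotated]) (auto split: bool.splits)
  then have "indep_sets (\<lambda>j. sigma_sets (space M) (\<Union>i\<in>case_bool {1..k} {Suc k} j. E i)) UNIV"
  proof (rule indep_sets_collect_sigma)
    show "Int_stable (E i)" for i
      unfolding E_def Int_stable_def
      by (safe, rule_tac x = "B \<inter> Ba" in exI) auto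
    show "disjoint_family_on (case_bool {1..k} {Suc k}) UNIV"
      by (auto simp: disjoint_family_on_def split: bool.splits)
  qed
  then have "indep_set (sets (history M Ws k)) (sigma_sets (space M) (E (Suc k)))"
    unfolding indep_set_def
    by (rule indep_sets_mono_sets) (auto simp: sets_history E_def split: bool.split)
  moreover have "Ws (Suc k) -` B \<inter> space M \<in> sigma_sets (space M) (E (Suc k))"
    using B by (auto simp: E_def intro!: sigma_sets.Basic)
  ultimately show ?thesis using A unfolding indep_sets2_eq by blast
qed

text \<open>Because the next observation is independent of the past, its joint law with \<open>X\<close> is a product,
  and Fubini's theorem allows the inner integral over the observation to be taken for frozen
  \<open>x\<close>. This plays the role of the vanishing of a conditional expectation.\<close>
lemma (in prob_space) expectation_conditionally_centered:
  fixes Ws :: "nat \<Rightarrow> 'a \<Rightarrow> 'w::topological_space" and h :: "'x \<times> 'w \<Rightarrow> real"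
  assumes ind: "indep_vars (\<lambda>_. borel) Ws {1..}" and X: "X \<in> measurable (history M Ws k) N"
    and h: "h \<in> borel_measurable (N \<Otimes>\<^sub>M borel)" and bdd: "\<And>z. \<bar>h z\<bar> \<le> B"
    and centered: "\<And>x. x \<in> space N \<Longrightarrow> (\<integral>w. h (x, w) \<partial>distr M borel (Ws (Suc k))) = 0"
  shows "(\<integral>\<omega>. h (X \<omega>, Ws (Suc k) \<omega>) \<partial>M) = 0"
proof -
  let ?W = "Ws (Suc k)"
  have Ws: "Ws i \<in> borel_measurable M" if "1 \<le> i" for i
    using ind that by (auto simp: indep_vars_def)
  then have W [measurable]: "?W \<in> borel_measurable M" by simp
  have XM [measurable]: "X \<in> measurable M N"
    by (rule measurable_from_subalg[OF subalgebra_history[OF Ws] X])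
  interpret P1: prob_space "distr M N X" by (rule prob_space_distr) fact
  interpret P2: prob_space "distr M borel ?W" by (rule prob_space_distr) fact
  interpret PP: pair_prob_space "distr M N X" "distr M borel ?W" ..
  have eq: "distr M N X \<Otimes>\<^sub>M distr M borel ?W = distr M (N \<Otimes>\<^sub>M borel) (\<lambda>\<omega>. (X \<omega>, ?W \<omega>))"
  proof (rule pair_measure_eqI)
    show "sigma_finite_measure (distr M N X)" "sigma_finite_measure (distr M borel ?W)"
      by unfold_locales
    show "sets (distr M N X \<Otimes>\<^sub>M distr M borel ?W) = sets (distr M (N \<Otimes>\<^sub>M borel) (\<lambda>\<omega>. (X \<omega>, ?W \<omega>)))"
      by (simp cong: sets_pair_measure_cong)
    fix A B assume "A \<in> sets (distr M N X)" "B \<in> sets (distr M borel ?W)"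
    then have A [measurable]: "A \<in> sets N" and B [measurable]: "B \<in> sets borel" by auto
    have "X -` A \<inter> space M \<in> sets (history M Ws k)" using measurable_sets[OF X A] by simp
    from prob_history_next_observation[OF ind this B]
    have "prob ((X -` A \<inter> space M) \<inter> (?W -` B \<inter> space M))
        = prob (X -` A \<inter> space M) * prob (?W -` B \<inter> space M)" .
    moreover have "(\<lambda>\<omega>. (X \<omega>, ?W \<omega>)) -` (A \<times> B) \<inter> space M = (X -` A \<inter> space M) \<inter> (?W -` B \<inter> space M)"
      by auto
    ultimately show "emeasure (distr M N X) A * emeasure (distr M borel ?W) B
        = emeasure (distr M (N \<Otimes>\<^sub>M borel) (\<lambda>\<omega>. (X \<omega>, ?W \<omega>))) (A \<times> B)"
      by (simp add: emeasure_distr emeasure_eq_measure ennreal_mult)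
  qed
  have "(\<integral>\<omega>. h (X \<omega>, ?W \<omega>) \<partial>M) = (\<integral>z. h z \<partial>distr M (N \<Otimes>\<^sub>M borel) (\<lambda>\<omega>. (X \<omega>, ?W \<omega>)))"
    using h by (subst integral_distr) auto
  also have "\<dots> = (\<integral>z. h z \<partial>(distr M N X \<Otimes>\<^sub>M distr M borel ?W))" by (simp only: eq)
  also have "\<dots> = (\<integral>x. (\<integral>w. h (x, w) \<partial>distr M borel ?W) \<partial>distr M N X)"
  proof (rule PP.integral_fst'[symmetric])
    show "integrable (distr M N X \<Otimes>\<^sub>M distr M borel ?W) h"
      by (rule PP.integrable_const_bound[of _ B])
        (use h bdd in \<open>auto cong: measurable_cong_sets\<close>)
  qed
  also have "\<dots> = (\<integral>x. 0 \<partial>distr M N X)"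
    by (rule Bochner_Integration.integral_cong) (auto simp: centered)
  finally show ?thesis by simp
qed

text \<open>Convergence of a martingale whose increments are bounded by square summable constants. The
  maximal inequality comes from the sums \<open>T\<close> that are stopped once they reach the level \<open>e\<close> in
  modulus. Orthogonality to the past still holds for the stopped increments, so the second
  moment of \<open>T n\<close> is at most a sum of \<open>(c k)^2\<close>. By Chebyshev's inequality late oscillations of
  size \<open>e\<close> then have arbitrarily small probability.\<close>
theorem (in prob_space) orthogonal_increments_summable:
  fixes X :: "nat \<Rightarrow> 'a \<Rightarrow> real"
  assumes sub: "\<And>k. subalgebra M (F k)" and mono: "\<And>k. sets (F k) \<subseteq> sets (F (Suc k))"
    and X: "\<And>k. X k \<in> borel_measurable (F (Suc k))"
    and bdd: "\<And>k \<omega>. \<omega> \<in> space M \<Longrightarrow> \<bar>X k \<omega>\<bar> \<le> c k" and c: "summable (\<lambda>k. (c k)\<^sup>2)"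
    and orth: "\<And>k Z B. Z \<in> borel_measurable (F k) \<Longrightarrow> (\<And>\<omega>. \<omega> \<in> space M \<Longrightarrow> \<bar>Z \<omega>\<bar> \<le> B) \<Longrightarrow>
      (\<integral>\<omega>. Z \<omega> * X k \<omega> \<partial>M) = 0"
  shows "AE \<omega> in M. summable (\<lambda>k. X k \<omega>)"
proof -
  have XM [measurable]: "X k \<in> borel_measurable M" for k by (rule measurable_from_subalg[OF sub X])
  have spF: "space (F k) = space M" for k using sub by (simp add: subalgebra_def)
  have up: "f \<in> borel_measurable (F (Suc k))" if "f \<in> borel_measurable (F k)" for f :: "'a \<Rightarrow> real" and k
    by (rule measurable_larger_sigma_algebra[OF _ mono that]) (simp add: spF)
  define S where "S = (\<lambda>s m \<omega>. \<Sum>i<m. X (s + i) \<omega>)"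
  have SM [measurable]: "S s m \<in> borel_measurable M" for s m unfolding S_def by measurable
  define tail where "tail = (\<lambda>s. \<Sum>i. (c (i + s))\<^sup>2)"
  have maximal: "prob {\<omega>\<in>space M. \<exists>m. e \<le> \<bar>S s m \<omega>\<bar>} \<le> tail s / e\<^sup>2" if e: "e > 0" for e s
  proof -
    define T where "T = rec_nat (\<lambda>\<omega>. 0 :: real)
      (\<lambda>n T \<omega>. T \<omega> + (if \<bar>T \<omega>\<bar> < e then 1 else 0) * X (s + n) \<omega>)"
    have T0: "T 0 \<omega> = 0" and TS: "T (Suc n) \<omega> = T n \<omega> + (if \<bar>T n \<omega>\<bar> < e then 1 else 0) * X (s + n) \<omega>"
      for n \<omega> by (simp_all add: T_def)
    have TF: "T n \<in> borel_measurable (F (s + n))" for n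
    proof (induction n)
      case 0
      then show ?case by (simp add: T_def)
    next
      case (Suc n)
      have [measurable]: "T n \<in> borel_measurable (F (Suc (s + n)))" "X (s + n) \<in> borel_measurable (F (Suc (s + n)))"
        using up[OF Suc] X by auto
      have "(\<lambda>\<omega>. T n \<omega> + (if \<bar>T n \<omega>\<bar> < e then 1 else 0) * X (s + n) \<omega>) \<in> borel_measurable (F (Suc (s + n)))"
        by measurable
      then show ?case by (simp add: T_def)
    qed
    have TM [measurable]: "T n \<in> borel_measurable M" for n by (rule measurable_from_subalg[OF sub TF])
    have c0: "0 \<le> c k" for k
    proof -
      obtain \<omega> where "\<omega> \<in> space M" using not_empty by blast
      then show ?thesis using bdd[of \<omega> k] by linarith
    qed
    have Tb: "\<bar>T n \<omega>\<bar> \<le> (\<Sum>i<n. c (s + i))" if "\<omega> \<in> space M" for n \<omega>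
    proof (induction n)
      case (Suc n)
      have "\<bar>(if \<bar>T n \<omega>\<bar> < e then 1 else 0) * X (s + n) \<omega>\<bar> \<le> c (s + n)"
        using bdd[OF that, of "s + n"] c0[of "s + n"] by auto
      with Suc show ?case unfolding TS by (simp add: abs_triangle_ineq[THEN order_trans])
    qed (simp add: T0)
    have int: "integrable M f" if "f \<in> borel_measurable M" "\<And>\<omega>. \<omega> \<in> space M \<Longrightarrow> \<bar>f \<omega>\<bar> \<le> B" for f :: "'a \<Rightarrow> real" and B
      by (rule integrable_const_bound[of _ B]) (use that in auto)
    have intT: "integrable M (\<lambda>\<omega>. (T n \<omega>)\<^sup>2)" for n
    proof (rule int[of _ "(\<Sum>i<n. c (s + i))\<^sup>2"])
      show "\<bar>(T n \<omega>)\<^sup>2\<bar> \<le> (\<Sum>i<n. c (s + i))\<^sup>2" if "\<omega> \<in> space M" for \<omega>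
        using power_mono[OF Tb[OF that, of n], of 2] by simp
    qed measurable
    have second: "(\<integral>\<omega>. (T n \<omega>)\<^sup>2 \<partial>M) \<le> (\<Sum>i<n. (c (s + i))\<^sup>2)" for n
    proof (induction n)
      case 0
      then show ?case by (simp add: T0)
    next
      case (Suc n)
      \<comment> \<open>Whether the sum is still running at time \<open>n\<close>; this is known from the past.\<close>
      define I where "I = (\<lambda>\<omega>. if \<bar>T n \<omega>\<bar> < e then 1 else (0::real))"
      have IF: "I \<in> borel_measurable (F (s + n))"
        unfolding I_def using TF[of n] by measurable
      have IM [measurable]: "I \<in> borel_measurable M" by (rule measurable_from_subalg[OF sub IF])
      have I01: "I \<omega> = 0 \<or> I \<omega> = 1" for \<omega> by (simp add: I_def)
      have TI: "T (Suc n) \<omega> = T n \<omega> + I \<omega> * X (s + n) \<omega>" for \<omega> by (simp add: TS I_def)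
      have TIb: "\<bar>T n \<omega> * I \<omega>\<bar> \<le> (\<Sum>i<n. c (s + i))" if "\<omega> \<in> space M" for \<omega>
        using Tb[OF that, of n] I01[of \<omega>] sum_nonneg[of "{..<n}" "\<lambda>i. c (s + i)"] c0 by auto
      have b1: "\<bar>T n \<omega> * I \<omega> * X (s + n) \<omega>\<bar> \<le> (\<Sum>i<n. c (s + i)) * c (s + n)" if "\<omega> \<in> space M" for \<omega>
        unfolding abs_mult[of _ "X (s + n) \<omega>"]
        by (rule mult_mono) (use TIb[OF that] bdd[OF that] c0 in \<open>auto intro!: sum_nonneg\<close>)
      have b2: "(I \<omega> * X (s + n) \<omega>)\<^sup>2 \<le> (c (s + n))\<^sup>2" if "\<omega> \<in> space M" for \<omega>
        using I01[of \<omega>] bdd[OF that, of "s + n"] c0[of "s + n"] by (auto simp: abs_le_square_iff[symmetric])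
      have i1: "integrable M (\<lambda>\<omega>. T n \<omega> * I \<omega> * X (s + n) \<omega>)"
        by (rule int[OF _ b1]) auto
      have i2: "integrable M (\<lambda>\<omega>. (I \<omega> * X (s + n) \<omega>)\<^sup>2)"
        by (rule int[of _ "(c (s + n))\<^sup>2"]) (use b2 in auto)
      have "(\<integral>\<omega>. (T (Suc n) \<omega>)\<^sup>2 \<partial>M)
          = (\<integral>\<omega>. (T n \<omega>)\<^sup>2 + 2 * (T n \<omega> * I \<omega> * X (s + n) \<omega>) + (I \<omega> * X (s + n) \<omega>)\<^sup>2 \<partial>M)"
        by (rule Bochner_Integration.integral_cong[OF refl])
          (simp add: TI power2_eq_square algebra_simps)
      also have "\<dots> = (\<integral>\<omega>. (T n \<omega>)\<^sup>2 \<partial>M) + 2 * (\<integral>\<omega>. T n \<omega> * I \<omega> * X (s + n) \<omega> \<partial>M)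
          + (\<integral>\<omega>. (I \<omega> * X (s + n) \<omega>)\<^sup>2 \<partial>M)"
        using intT[of n] i1 i2 by simp
      also have "(\<integral>\<omega>. T n \<omega> * I \<omega> * X (s + n) \<omega> \<partial>M) = 0"
        by (rule orth[OF _ TIb]) (use TF IF in auto)
      also have "(\<integral>\<omega>. (I \<omega> * X (s + n) \<omega>)\<^sup>2 \<partial>M) \<le> (\<integral>\<omega>. (c (s + n))\<^sup>2 \<partial>M)"
        by (rule integral_mono[OF i2]) (use b2 in auto)
      finally show ?case using Suc by (simp add: prob_space)
    qed
    \<comment> \<open>Up to the first passage of level \<open>e\<close> the stopped sum agrees with the sum; afterwards it is frozen.\<close>
    have stopped: "e \<le> \<bar>T n \<omega>\<bar> \<or> (T n \<omega> = S s n \<omega> \<and> (\<forall>m\<le>n. \<bar>S s m \<omega>\<bar> < e))" for n \<omega>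
    proof (induction n)
      case 0
      then show ?case using e by (simp add: T0 S_def)
    next
      case (Suc n)
      then show ?case
      proof
        assume "e \<le> \<bar>T n \<omega>\<bar>"
        then show ?thesis by (simp add: TS)
      next
        assume *: "T n \<omega> = S s n \<omega> \<and> (\<forall>m\<le>n. \<bar>S s m \<omega>\<bar> < e)"
        then have "\<bar>T n \<omega>\<bar> < e" by auto
        then have "T (Suc n) \<omega> = S s (Suc n) \<omega>" using * by (simp add: TS S_def)
        then show ?thesis using * by (auto simp: le_Suc_eq)
      qed
    qed
    define A where "A = (\<lambda>n. {\<omega>\<in>space M. \<exists>m\<le>n. e \<le> \<bar>S s m \<omega>\<bar>})"
    have A [measurable]: "A n \<in> sets M" for n unfolding A_def by measurable
    have PA: "prob (A n) \<le> tail s / e\<^sup>2" for n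
    proof -
      have "e\<^sup>2 * prob (A n) = (\<integral>\<omega>. e\<^sup>2 * indicator (A n) \<omega> \<partial>M)" by simp
      also have "\<dots> \<le> (\<integral>\<omega>. (T n \<omega>)\<^sup>2 \<partial>M)"
      proof (rule integral_mono)
        show "integrable M (\<lambda>\<omega>. e\<^sup>2 * indicator (A n) \<omega>)"
          by (rule int[of _ "e\<^sup>2"]) (auto simp: indicator_def)
        fix \<omega>
        show "e\<^sup>2 * indicator (A n) \<omega> \<le> (T n \<omega>)\<^sup>2"
        proof (cases "\<omega> \<in> A n")
          case True
          then have "e \<le> \<bar>T n \<omega>\<bar>" using stopped[of n \<omega>] by (force simp: A_def)
          then have "e\<^sup>2 \<le> \<bar>T n \<omega>\<bar>\<^sup>2" using e by (intro power_mono) auto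
          then show ?thesis using True by simp
        qed simp
      qed (rule intT)
      also have "\<dots> \<le> (\<Sum>i<n. (c (s + i))\<^sup>2)" by (rule second)
      also have "\<dots> \<le> tail s"
        unfolding tail_def add.commute[of s]
        by (rule sum_le_suminf) (use c in \<open>auto simp: summable_iff_shift[of "\<lambda>k. (c k)\<^sup>2"]\<close>)
      finally show ?thesis using e by (simp add: pos_le_divide_eq mult.commute)
    qed
    have "(\<lambda>n. prob (A n)) \<longlonglongrightarrow> prob (\<Union>n. A n)"
      by (rule finite_Lim_measure_incseq) (auto simp: incseq_def A_def dest: order_trans)
    then have "prob (\<Union>n. A n) \<le> tail s / e\<^sup>2" using PA by (intro LIMSEQ_le_const2) auto
    moreover have "(\<Union>n. A n) = {\<omega>\<in>space M. \<exists>m. e \<le> \<bar>S s m \<omega>\<bar>}" by (auto simp: A_def)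
    ultimately show ?thesis by simp
  qed
  have "AE \<omega> in M. \<exists>s. \<forall>m. \<bar>S s m \<omega>\<bar> < e" if e: "e > 0" for e
  proof -
    define N where "N = {\<omega>\<in>space M. \<forall>s. \<exists>m. e \<le> \<bar>S s m \<omega>\<bar>}"
    have N [measurable]: "N \<in> sets M" unfolding N_def by measurable
    have "prob N \<le> 0 + r" if r: "r > 0" for r
    proof -
      obtain s where "norm (tail s) < r * e\<^sup>2"
        using suminf_exist_split[OF _ c, of "r * e\<^sup>2"] r e unfolding tail_def by auto
      then have "tail s / e\<^sup>2 \<le> r" using e by (simp add: pos_divide_le_eq)
      moreover have "prob N \<le> prob {\<omega>\<in>space M. \<exists>m. e \<le> \<bar>S s m \<omega>\<bar>}"
        by (rule finite_measure_mono) (auto simp: N_def)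
      ultimately show ?thesis using maximal[OF e, of s] by linarith
    qed
    then have "prob N \<le> 0" by (rule field_le_epsilon)
    then have "prob N = 0" using measure_nonneg[of M N] by linarith
    then have "emeasure M N = 0" by (simp add: emeasure_eq_measure)
    then show ?thesis by (intro AE_I[of M _ N]) (auto simp: N_def not_less)
  qed
  then have "AE \<omega> in M. \<forall>j. \<exists>s. \<forall>m. \<bar>S s m \<omega>\<bar> < 1 / Suc j" by (simp add: AE_all_countable)
  then show ?thesis
  proof eventually_elim
    case (elim \<omega>)
    show ?case
      unfolding summable_Cauchy
    proof (intro allI impI)
      fix e :: real assume "e > 0"
      then obtain j where j: "1 / real (Suc j) < e / 2" using nat_approx_posE[of "e / 2"] by auto
      obtain s where s: "\<And>m. \<bar>S s m \<omega>\<bar> < 1 / Suc j" using elim by blast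
      have "\<bar>\<Sum>k=m..<n. X k \<omega>\<bar> < e" if m: "s \<le> m" for m n
      proof (cases "m \<le> n")
        case True
        have S: "(\<Sum>k=s..<l. X k \<omega>) = S s (l - s) \<omega>" if "s \<le> l" for l
          using sum.shift_bounds_nat_ivl[of "\<lambda>k. X k \<omega>" 0 s "l - s"] that
          by (simp add: S_def add.commute lessThan_atLeast0)
        have "(\<Sum>k=m..<n. X k \<omega>) = S s (n - s) \<omega> - S s (m - s) \<omega>"
          using sum.atLeastLessThan_concat[OF m True, of "\<lambda>k. X k \<omega>"] S[of n] S[of m] m True by simp
        then show ?thesis using s[of "n - s"] s[of "m - s"] j by linarith
      qed (use \<open>e > 0\<close> in simp)
      then show "\<exists>N. \<forall>m\<ge>N. \<forall>n. norm (\<Sum>k=m..<n. X k \<omega>) < e" by auto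
    qed
  qed
qed

text \<open>The partial sums of the conditional expectations up to index \<open>k\<close> are known at time \<open>k\<close>.
  Retaining only the terms with partial sum at most \<open>N\<close> gives a series with expectation at most
  \<open>N\<close>, and this truncated series agrees with the original one on the paths where the full sum is
  at most \<open>N\<close>.\<close>
theorem (in prob_space) suminf_finite_of_cond_exp:
  fixes g :: "nat \<Rightarrow> 'a \<Rightarrow> ennreal" and a :: "nat \<Rightarrow> ennreal"
  assumes sub: "\<And>k. subalgebra M (F k)" and mono: "\<And>k l. k \<le> l \<Longrightarrow> sets (F k) \<subseteq> sets (F l)"
    and g [measurable]: "\<And>k. g k \<in> borel_measurable M"
    and fin: "AE \<omega> in M. (\<Sum>k. a k * nn_cond_exp M (F k) (g k) \<omega>) < \<infinity>"
  shows "AE \<omega> in M. (\<Sum>k. a k * g k \<omega>) < \<infinity>"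
proof -
  define C where "C = (\<lambda>k \<omega>. a k * nn_cond_exp M (F k) (g k) \<omega>)"
  have spF: "space (F k) = space M" for k using sub by (simp add: subalgebra_def)
  have CF: "C i \<in> borel_measurable (F k)" if "i \<le> k" for i k
    by (rule measurable_larger_sigma_algebra[OF _ mono[OF that]]) (auto simp: C_def spF)
  define I :: "nat \<Rightarrow> nat \<Rightarrow> 'a \<Rightarrow> ennreal"
    where "I = (\<lambda>N k \<omega>. if (\<Sum>i\<le>k. C i \<omega>) \<le> of_nat N then 1 else 0)"
  have IF: "I N k \<in> borel_measurable (F k)" for N k
    unfolding I_def using CF[of _ k] by measurable
  have IM [measurable]: "I N k \<in> borel_measurable M" for N k by (rule measurable_from_subalg[OF sub IF])
  have CM [measurable]: "C k \<in> borel_measurable M" for k by (rule measurable_from_subalg[OF sub CF[OF order_refl]])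
  have "AE \<omega> in M. (\<Sum>k. a k * (I N k \<omega> * g k \<omega>)) \<noteq> \<infinity>" for N
  proof (rule nn_integral_noteq_infinite)
    have "(\<integral>\<^sup>+\<omega>. (\<Sum>k. a k * (I N k \<omega> * g k \<omega>)) \<partial>M) = (\<Sum>k. a k * (\<integral>\<^sup>+\<omega>. I N k \<omega> * g k \<omega> \<partial>M))"
      by (simp add: nn_integral_suminf nn_integral_cmult)
    also have "\<dots> = (\<Sum>k. a k * (\<integral>\<^sup>+\<omega>. I N k \<omega> * nn_cond_exp M (F k) (g k) \<omega> \<partial>M))"
    proof (intro suminf_cong arg_cong2[of _ _ _ _ "(*)"] refl)
      fix k
      interpret finite_measure_subalgebra M "F k" by unfold_locales (rule sub)
      show "(\<integral>\<^sup>+\<omega>. I N k \<omega> * g k \<omega> \<partial>M) = (\<integral>\<^sup>+\<omega>. I N k \<omega> * nn_cond_exp M (F k) (g k) \<omega> \<partial>M)"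
        by (rule nn_cond_exp_intg[symmetric]) (auto intro: IF)
    qed
    also have "\<dots> = (\<integral>\<^sup>+\<omega>. (\<Sum>k. I N k \<omega> * C k \<omega>) \<partial>M)"
      by (simp add: nn_integral_suminf nn_integral_cmult[symmetric] C_def mult_ac)
    also have "\<dots> \<le> (\<integral>\<^sup>+\<omega>. of_nat N \<partial>M)"
    proof (rule nn_integral_mono)
      fix \<omega>
      have "(\<Sum>k<n. I N k \<omega> * C k \<omega>) \<le> of_nat N" for n
      proof (induction n)
        case (Suc n)
        show ?case
        proof (cases "(\<Sum>i\<le>n. C i \<omega>) \<le> of_nat N")
          case True
          have "(\<Sum>k<Suc n. I N k \<omega> * C k \<omega>) \<le> (\<Sum>k<Suc n. C k \<omega>)"
            by (rule sum_mono) (simp add: I_def)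
          also have "\<dots> = (\<Sum>i\<le>n. C i \<omega>)" by (simp add: lessThan_Suc_atMost)
          finally show ?thesis using True by (rule order_trans)
        next
          case False
          then show ?thesis using Suc by (simp add: I_def)
        qed
      qed simp
      then show "(\<Sum>k. I N k \<omega> * C k \<omega>) \<le> of_nat N" by (intro suminf_le_const) auto
    qed
    also have "\<dots> < \<infinity>" by (simp add: emeasure_space_1 of_nat_less_top)
    finally show "(\<integral>\<^sup>+\<omega>. (\<Sum>k. a k * (I N k \<omega> * g k \<omega>)) \<partial>M) \<noteq> \<infinity>" by simp
  qed simp
  then have "AE \<omega> in M. \<forall>N. (\<Sum>k. a k * (I N k \<omega> * g k \<omega>)) \<noteq> \<infinity>" by (simp add: AE_all_countable)
  then show ?thesis using fin
  proof eventually_elim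
    case (elim \<omega>)
    then have "(\<Sum>k. C k \<omega>) < \<infinity>" by (simp add: C_def)
    then obtain N where N: "(\<Sum>k. C k \<omega>) \<le> of_nat N"
      using ennreal_Ex_less_of_nat[of "\<Sum>k. C k \<omega>"] by (auto intro: less_imp_le)
    have "I N k \<omega> = 1" for k
    proof -
      have "(\<Sum>i\<le>k. C i \<omega>) \<le> (\<Sum>k. C k \<omega>)" by (rule sum_le_suminf) auto
      then show ?thesis using N by (simp add: I_def)
    qed
    then show ?case using elim(1)[rule_format, of N] by (simp add: less_top)
  qed
qed

section \<open>One step of the algorithm and Bregman distances\<close>

definition bregman :: "('u::real_normed_vector \<Rightarrow> real) \<Rightarrow> ('u \<Rightarrow> 'u \<Rightarrow>\<^sub>L real) \<Rightarrow> 'u \<Rightarrow> 'u \<Rightarrow> real" where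
  "bregman K gradK u x = K u - K x - blinfun_apply (gradK x) (u - x)"

text \<open>A subgradient at either end point bounds the difference from one side.\<close>
lemma subgradient_growth_lipschitz:
  fixes f :: "'u::real_normed_vector \<Rightarrow> real"
  assumes ne: "\<And>u. u \<in> S \<Longrightarrow> subdifferential f u \<noteq> {}"
    and growth: "\<And>u r. u \<in> S \<Longrightarrow> r \<in> subdifferential f u \<Longrightarrow> norm r \<le> c1 * norm u + c2"
    and c: "c1 \<ge> 0" "c2 \<ge> 0" and uv: "u \<in> S" "v \<in> S"
  shows "\<bar>f u - f v\<bar> \<le> (c1 * (norm u + norm v) + c2) * norm (u - v)"
proof -
  have "f x - f y \<le> (c1 * (norm x + norm y) + c2) * norm (x - y)" if xy: "x \<in> S" "y \<in> S" for x y
  proof -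
    obtain r where r: "r \<in> subdifferential f x" using ne[OF xy(1)] by blast
    then have "f x - f y \<le> blinfun_apply r (x - y)"
      by (auto simp: subdifferential_def blinfun.diff_right dest: spec[of _ y])
    also have "\<dots> \<le> norm r * norm (x - y)" using norm_blinfun[of r "x - y"] by simp
    also have "\<dots> \<le> (c1 * (norm x + norm y) + c2) * norm (x - y)"
    proof (rule mult_right_mono)
      have "0 \<le> c1 * norm y" using c by simp
      then show "norm r \<le> c1 * (norm x + norm y) + c2"
        using growth[OF xy(1) r] by (simp add: distrib_left)
    qed simp
    finally show ?thesis .
  qed
  from this[OF uv] this[OF uv(2,1)] show ?thesis
    by (simp add: abs_le_iff norm_minus_commute add.commute)
qed

text \<open>First-order optimality along the segment from \<open>p\<close> to \<open>u\<close>: the smooth part is differentiated, the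
  convex part \<open>\<phi>\<close> is only estimated by its chord.\<close>
lemma variational_inequality:
  fixes K :: "'u::real_normed_vector \<Rightarrow> real"
  assumes S: "convex S" and K: "has_gateaux_derivative K D p" and \<phi>: "convex_on UNIV \<phi>" and e: "e \<ge> 0"
    and min: "is_arg_min (\<lambda>u. K u + blinfun_apply l u + e * \<phi> u) (\<lambda>u. u \<in> S) p" and u: "u \<in> S"
  shows "0 \<le> blinfun_apply D (u - p) + blinfun_apply l (u - p) + e * (\<phi> u - \<phi> p)"
proof -
  define h where "h = u - p"
  define q where "q = (\<lambda>t. (K (p + t *\<^sub>R h) - K p) / t)"
  have p: "p \<in> S" using min by (simp add: is_arg_min_linorder)
  have "((\<lambda>t. K (p + t *\<^sub>R h)) has_real_derivative blinfun_apply D h) (at 0)"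
    using K by (simp add: has_gateaux_derivative_def)
  then have "(q \<longlongrightarrow> blinfun_apply D h) (at 0)" by (simp add: DERIV_def q_def)
  then have lim: "(q \<longlongrightarrow> blinfun_apply D h) (at_right 0)" by (rule tendsto_within_subset) simp
  have "eventually (\<lambda>t::real. t \<in> {0<..<1}) (at_right 0)"
    by (rule eventually_at_right_real) simp
  then have "eventually (\<lambda>t. - (blinfun_apply l h + e * (\<phi> u - \<phi> p)) \<le> q t) (at_right 0)"
  proof eventually_elim
    case (elim t)
    have eq: "p + t *\<^sub>R h = t *\<^sub>R u + (1 - t) *\<^sub>R p" by (simp add: h_def algebra_simps)
    have "p + t *\<^sub>R h \<in> S" unfolding eq by (rule convexD[OF S u p]) (use elim in auto)
    then have "K p + blinfun_apply l p + e * \<phi> p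
        \<le> K (p + t *\<^sub>R h) + blinfun_apply l (p + t *\<^sub>R h) + e * \<phi> (p + t *\<^sub>R h)"
      using min by (simp add: is_arg_min_linorder)
    moreover have "\<phi> (p + t *\<^sub>R h) \<le> t * \<phi> u + (1 - t) * \<phi> p"
      unfolding eq using \<phi> elim by (auto simp: convex_on_def)
    then have "e * \<phi> (p + t *\<^sub>R h) \<le> e * (t * \<phi> u + (1 - t) * \<phi> p)"
      using e by (rule mult_left_mono)
    ultimately have "- (blinfun_apply l h + e * (\<phi> u - \<phi> p)) * t \<le> K (p + t *\<^sub>R h) - K p"
      by (simp add: blinfun.add_right blinfun.scaleR_right algebra_simps)
    then show ?case using elim by (simp add: q_def pos_le_divide_eq)
  qed
  then have "- (blinfun_apply l h + e * (\<phi> u - \<phi> p)) \<le> blinfun_apply D h"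
    using lim by (intro tendsto_lowerbound[of q _ "at_right 0"]) auto
  then show ?thesis by (simp add: h_def)
qed

text \<open>Here \<open>x\<close> is the current iterate, \<open>p\<close> the next one, \<open>\<psi>\<close> and \<open>\<phi>\<close> are the two sampled costs. The
  Bregman distances satisfy the three-point identity in which the distance from \<open>p\<close> to \<open>x\<close>
  occurs with a negative sign. The resulting term \<open>- b/2 (norm (p - x))^2\<close> absorbs, by Young's
  inequality, all contributions of \<open>g\<close>, \<open>s\<close> and \<open>r\<close> that are proportional to \<open>norm (p - x)\<close>;
  what is left is of order \<open>e^2\<close>. The bound on the step length is the variational inequality at
  \<open>u = x\<close> together with strong monotonicity of \<open>gradK\<close>.\<close>
lemma app_step_estimates:
  fixes K :: "'u::real_normed_vector \<Rightarrow> real"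
  assumes b: "b > 0" and e: "e \<ge> 0"
    and strong: "\<And>u v. K u + blinfun_apply (gradK u) (v - u) + b / 2 * (norm (u - v))\<^sup>2 \<le> K v"
    and vi: "\<And>u. u \<in> S \<Longrightarrow> 0 \<le> blinfun_apply (gradK p) (u - p)
      + blinfun_apply (e *\<^sub>R (g + r) - gradK x) (u - p) + e * (\<phi> u - \<phi> p)"
    and g: "g \<in> subdifferential \<psi> x" and s: "s \<in> subdifferential \<phi> x" and A: "norm g + norm s \<le> A"
  shows "x \<in> S \<Longrightarrow> norm (p - x) \<le> e * (A + norm r) / b"
    and "u \<in> S \<Longrightarrow> bregman K gradK u p \<le> bregman K gradK u x + e * ((\<psi> u + \<phi> u) - (\<psi> x + \<phi> x))
      + e * norm r * norm (u - x) + e\<^sup>2 * (A + norm r)\<^sup>2 / (2 * b)"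
proof -
  define \<delta> where "\<delta> = norm (p - x)"
  have bl: "\<bar>blinfun_apply f y\<bar> \<le> norm f * norm y" for f :: "'u \<Rightarrow>\<^sub>L real" and y
    using norm_blinfun[of f y] by simp
  have \<phi>p: "\<phi> x - \<phi> p \<le> norm s * \<delta>"
  proof -
    have "\<phi> p \<ge> \<phi> x + blinfun_apply s (p - x)" using s by (simp add: subdifferential_def)
    then show ?thesis using bl[of s "p - x"] by (simp add: \<delta>_def)
  qed
  have gp: "blinfun_apply g (x - p) \<le> norm g * \<delta>" and rp: "blinfun_apply r (x - p) \<le> norm r * \<delta>"
    using bl[of g "x - p"] bl[of r "x - p"] by (auto simp: \<delta>_def norm_minus_commute)
  have sum: "blinfun_apply g (x - p) + blinfun_apply r (x - p) + (\<phi> x - \<phi> p) \<le> (A + norm r) * \<delta>"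
  proof -
    have "(norm g + norm s) * \<delta> \<le> A * \<delta>" using A by (intro mult_right_mono) (auto simp: \<delta>_def)
    then show ?thesis using \<phi>p gp rp by (simp add: distrib_right)
  qed
  show "norm (p - x) \<le> e * (A + norm r) / b" if x: "x \<in> S"
  proof (cases "\<delta> = 0")
    case True
    have "0 \<le> A" using A norm_ge_zero[of g] norm_ge_zero[of s] by linarith
    then show ?thesis using True b e by (simp add: \<delta>_def)
  next
    case False
    then have \<delta>: "\<delta> > 0" by (simp add: \<delta>_def)
    have "b * \<delta>\<^sup>2 \<le> blinfun_apply (gradK p) (p - x) - blinfun_apply (gradK x) (p - x)"
      using strong[of p x] strong[of x p]
      by (simp add: \<delta>_def norm_minus_commute blinfun.diff_right)
    also have "\<dots> \<le> e * (blinfun_apply g (x - p) + blinfun_apply r (x - p) + (\<phi> x - \<phi> p))"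
      using vi[OF x]
      by (simp add: blinfun.diff_right blinfun.diff_left blinfun.add_left blinfun.scaleR_left algebra_simps)
    also have "\<dots> \<le> e * ((A + norm r) * \<delta>)" using sum e by (intro mult_left_mono)
    finally have "(b * \<delta>) * \<delta> \<le> (e * (A + norm r)) * \<delta>" by (simp add: power2_eq_square mult_ac)
    then have "b * \<delta> \<le> e * (A + norm r)" using \<delta> by simp
    then show ?thesis using b by (simp add: \<delta>_def pos_le_divide_eq mult.commute)
  qed
  assume u: "u \<in> S"
  have "bregman K gradK u p - bregman K gradK u x
      = - bregman K gradK p x + (blinfun_apply (gradK x) (u - p) - blinfun_apply (gradK p) (u - p))"
    by (simp add: bregman_def blinfun.diff_right)
  also have "\<dots> \<le> - (b / 2 * \<delta>\<^sup>2) + e * (blinfun_apply g (u - p) + blinfun_apply r (u - p) + (\<phi> u - \<phi> p))" (is "_ \<le> ?R")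
  proof -
    have "b / 2 * \<delta>\<^sup>2 \<le> bregman K gradK p x"
      using strong[of x p] by (simp add: bregman_def \<delta>_def norm_minus_commute)
    moreover have "blinfun_apply (gradK x) (u - p) - blinfun_apply (gradK p) (u - p)
        \<le> e * (blinfun_apply g (u - p) + blinfun_apply r (u - p) + (\<phi> u - \<phi> p))"
      using vi[OF u]
      by (simp add: blinfun.diff_left blinfun.add_left blinfun.scaleR_left algebra_simps)
    ultimately show ?thesis by linarith
  qed
  finally have main: "bregman K gradK u p - bregman K gradK u x \<le> ?R" .
  have "blinfun_apply g (u - p) + blinfun_apply r (u - p) + (\<phi> u - \<phi> p)
      \<le> ((\<psi> u + \<phi> u) - (\<psi> x + \<phi> x)) + norm r * norm (u - x) + (A + norm r) * \<delta>"
  proof -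
    have "blinfun_apply g (u - x) \<le> \<psi> u - \<psi> x" using g by (simp add: subdifferential_def algebra_simps)
    moreover have "blinfun_apply r (u - x) \<le> norm r * norm (u - x)" using bl[of r "u - x"] by simp
    moreover have "blinfun_apply f (u - p) = blinfun_apply f (u - x) + blinfun_apply f (x - p)"
      for f :: "'u \<Rightarrow>\<^sub>L real" by (simp add: blinfun.diff_right)
    ultimately show ?thesis using sum by simp
  qed
  then have pairing: "e * (blinfun_apply g (u - p) + blinfun_apply r (u - p) + (\<phi> u - \<phi> p))
      \<le> e * (((\<psi> u + \<phi> u) - (\<psi> x + \<phi> x)) + norm r * norm (u - x) + (A + norm r) * \<delta>)"
    using e by (rule mult_left_mono)
  have young: "e * ((A + norm r) * \<delta>) \<le> b / 2 * \<delta>\<^sup>2 + e\<^sup>2 * (A + norm r)\<^sup>2 / (2 * b)"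
  proof -
    have "0 \<le> (b * \<delta> - e * (A + norm r))\<^sup>2 / (2 * b)" using b by simp
    also have "\<dots> = b / 2 * \<delta>\<^sup>2 + e\<^sup>2 * (A + norm r)\<^sup>2 / (2 * b) - e * ((A + norm r) * \<delta>)"
      using b by (simp add: power2_eq_square field_simps)
    finally show ?thesis by simp
  qed
  show "bregman K gradK u p \<le> bregman K gradK u x + e * ((\<psi> u + \<phi> u) - (\<psi> x + \<phi> x))
      + e * norm r * norm (u - x) + e\<^sup>2 * (A + norm r)\<^sup>2 / (2 * b)"
    using main pairing young unfolding distrib_left[of e] mult.assoc[of e] by linarith
qed

text \<open>The gradient inequality at both points squeezes \<open>K u\<close> between two expressions tending to \<open>K v\<close>.\<close>
lemma continuous_of_gradient_inequality:
  fixes K :: "'u::real_normed_vector \<Rightarrow> real"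
  assumes "continuous_on UNIV gradK"
    and "\<And>u v. K u + blinfun_apply (gradK u) (v - u) \<le> K v"
  shows "continuous_on UNIV K"
proof -
  have "(K \<longlongrightarrow> K v) (at v)" for v
  proof (rule tendsto_sandwich)
    have "((\<lambda>u. u) \<longlongrightarrow> v) (at v)" and "(gradK \<longlongrightarrow> gradK v) (at v)"
      using assms(1) by (auto simp: continuous_on_eq_continuous_at isCont_def)
    note t = this
    have "((\<lambda>u. K v + blinfun_apply (gradK v) (u - v)) \<longlongrightarrow> K v + blinfun_apply (gradK v) (v - v)) (at v)"
      by (intro tendsto_intros t)
    then show "((\<lambda>u. K v + blinfun_apply (gradK v) (u - v)) \<longlongrightarrow> K v) (at v)" by simp
    have "((\<lambda>u. K v - blinfun_apply (gradK u) (v - u)) \<longlongrightarrow> K v - blinfun_apply (gradK v) (v - v)) (at v)"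
      by (intro tendsto_intros t)
    then show "((\<lambda>u. K v - blinfun_apply (gradK u) (v - u)) \<longlongrightarrow> K v) (at v)" by simp
    show "\<forall>\<^sub>F u in at v. K v + blinfun_apply (gradK v) (u - v) \<le> K u" using assms(2) by simp
    show "\<forall>\<^sub>F u in at v. K u \<le> K v - blinfun_apply (gradK u) (v - u)"
      using assms(2) by (simp add: le_diff_eq)
  qed
  then show ?thesis by (simp add: continuous_on_eq_continuous_at isCont_def)
qed

text \<open>Bregman distances to the points \<open>X k\<close> depend continuously on \<open>u\<close>, uniformly in \<open>k\<close>. An almost
  sure statement for each \<open>u\<close> in a countable dense set therefore holds almost surely for all \<open>u\<close>
  at once.\<close>
lemma convergent_bregman_closure:
  fixes K :: "'u::real_normed_vector \<Rightarrow> real"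
  assumes K: "continuous_on UNIV K" and G: "\<And>k. norm (gradK (X k)) \<le> G"
    and conv: "\<And>u. u \<in> D \<Longrightarrow> convergent (\<lambda>k. bregman K gradK u (X k))" and u: "u \<in> closure D"
  shows "convergent (\<lambda>k. bregman K gradK u (X k))"
  unfolding Cauchy_convergent_iff[symmetric]
proof (rule metric_CauchyI)
  fix e :: real assume e: "e > 0"
  have G0: "0 \<le> G" using G[of 0] norm_ge_zero order_trans by blast
  have lim: "(\<lambda>x. \<bar>K u - K x\<bar> + G * norm (u - x)) \<midarrow>u\<rightarrow> \<bar>K u - K u\<bar> + G * norm (u - u)"
    using K by (intro tendsto_intros) (auto simp: continuous_on_eq_continuous_at isCont_def)
  have "eventually (\<lambda>x. \<bar>K u - K x\<bar> + G * norm (u - x) < e / 3) (at u)"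
    by (rule order_tendstoD(2)[OF lim]) (use e in simp)
  then obtain d where d: "d > 0" "\<And>x. x \<noteq> u \<Longrightarrow> dist x u < d \<Longrightarrow> \<bar>K u - K x\<bar> + G * norm (u - x) < e / 3"
    unfolding eventually_at by blast
  obtain y where y: "y \<in> D" "dist y u < d" using u d(1) closure_approachable by blast
  then have small: "\<bar>K u - K y\<bar> + G * norm (u - y) < e / 3" using d(2)[of y] e by (cases "y = u") auto
  have near: "\<bar>bregman K gradK u (X k) - bregman K gradK y (X k)\<bar> < e / 3" for k
  proof -
    have "\<bar>blinfun_apply (gradK (X k)) (u - y)\<bar> \<le> norm (gradK (X k)) * norm (u - y)"
      using norm_blinfun[of "gradK (X k)" "u - y"] by simp
    also have "\<dots> \<le> G * norm (u - y)" by (intro mult_right_mono G) simp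
    moreover have "bregman K gradK u (X k) - bregman K gradK y (X k)
        = (K u - K y) - blinfun_apply (gradK (X k)) (u - y)"
      by (simp add: bregman_def blinfun.diff_right)
    ultimately show ?thesis using small by linarith
  qed
  have "Cauchy (\<lambda>k. bregman K gradK y (X k))" using conv[OF y(1)] by (simp add: Cauchy_convergent_iff)
  then obtain N where N: "\<And>m n. m \<ge> N \<Longrightarrow> n \<ge> N \<Longrightarrow>
      dist (bregman K gradK y (X m)) (bregman K gradK y (X n)) < e / 3"
    using metric_CauchyD[of _ "e / 3"] e by (metis divide_pos_pos zero_less_numeral)
  have "dist (bregman K gradK u (X m)) (bregman K gradK u (X n)) < e" if "m \<ge> N" "n \<ge> N" for m n
    using N[OF that] near[of m] near[of n] unfolding dist_real_def by linarith
  then show "\<exists>N. \<forall>m\<ge>N. \<forall>n\<ge>N. dist (bregman K gradK u (X m)) (bregman K gradK u (X n)) < e" by blast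
qed

text \<open>An analogue of Opial's lemma for Bregman distances. For cluster points \<open>x\<close> and \<open>y\<close> the
  difference of the distances is an affine function of \<open>gradK (X k) (x - y)\<close>, which therefore
  converges along the whole sequence. Evaluating its limit along the two filters gives
  \<open>gradK x (x - y) = gradK y (x - y)\<close>, and strong monotonicity yields \<open>x = y\<close>.\<close>
theorem weakly_convergent_of_bregman_convergent:
  fixes K :: "'u::real_normed_vector \<Rightarrow> real" and X :: "nat \<Rightarrow> 'u"
  assumes refl: "reflexive_space TYPE('u)" and b: "b > 0"
    and strong: "\<And>u v. K u + blinfun_apply (gradK u) (v - u) + b / 2 * (norm (u - v))\<^sup>2 \<le> K v"
    and weak: "continuous_map weak_topology weak_topology gradK"
    and bdd: "\<And>k. norm (X k) \<le> C"
    and conv: "\<And>u. u \<in> T \<Longrightarrow> convergent (\<lambda>k. bregman K gradK u (X k))"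
    and cluster: "\<And>F x. F \<noteq> bot \<Longrightarrow> F \<le> sequentially \<Longrightarrow> limitin weak_topology X x F \<Longrightarrow> x \<in> T"
  shows "\<exists>u\<in>T. limitin weak_topology X u sequentially"
proof -
  have grad_lim: "((\<lambda>k. blinfun_apply (gradK (X k)) h) \<longlongrightarrow> blinfun_apply (gradK x) h) F"
    if "limitin weak_topology X x F" for x h F
  proof -
    have "limitin weak_topology (gradK \<circ> X) (gradK x) F"
      using continuous_map_limit[OF weak that] .
    then have "((\<lambda>k. blinfun_apply (Blinfun (\<lambda>g :: 'u \<Rightarrow>\<^sub>L real. blinfun_apply g h)) (gradK (X k)))
        \<longlongrightarrow> blinfun_apply (Blinfun (\<lambda>g :: 'u \<Rightarrow>\<^sub>L real. blinfun_apply g h)) (gradK x)) F"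
      by (simp add: limitin_weak_topology)
    moreover have "bounded_linear (\<lambda>g :: 'u \<Rightarrow>\<^sub>L real. blinfun_apply g h)"
      by (rule blinfun.bounded_linear_left)
    ultimately show ?thesis by (simp add: bounded_linear_Blinfun_apply)
  qed
  have uniq: "x = y"
    if F: "F \<noteq> bot" "F \<le> sequentially" "limitin weak_topology X x F"
      and G: "G \<noteq> bot" "G \<le> sequentially" "limitin weak_topology X y G" for F G x y
  proof -
    have "convergent (\<lambda>k. bregman K gradK x (X k) - bregman K gradK y (X k))"
      using conv[OF cluster[OF F]] conv[OF cluster[OF G]] by (rule convergent_diff)
    then obtain l where l: "(\<lambda>k. bregman K gradK x (X k) - bregman K gradK y (X k)) \<longlonglongrightarrow> l"
      by (auto simp: convergent_def)
    have eq: "(\<lambda>k. K x - K y - (bregman K gradK x (X k) - bregman K gradK y (X k)))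
        = (\<lambda>k. blinfun_apply (gradK (X k)) (x - y))"
      by (simp add: bregman_def blinfun.diff_right)
    have lim: "(\<lambda>k. blinfun_apply (gradK (X k)) (x - y)) \<longlonglongrightarrow> K x - K y - l"
      unfolding eq[symmetric] by (intro tendsto_intros l)
    have "blinfun_apply (gradK x) (x - y) = K x - K y - l"
      by (rule tendsto_unique[OF F(1) grad_lim[OF F(3)] tendsto_mono[OF F(2) lim]])
    moreover have "blinfun_apply (gradK y) (x - y) = K x - K y - l"
      by (rule tendsto_unique[OF G(1) grad_lim[OF G(3)] tendsto_mono[OF G(2) lim]])
    ultimately have "b * (norm (x - y))\<^sup>2 \<le> 0"
      using strong[of x y] strong[of y x] by (simp add: norm_minus_commute blinfun.diff_right)
    then show ?thesis using b by (simp add: mult_le_0_iff)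
  qed
  have bdd': "eventually (\<lambda>k. norm (X k) \<le> C) sequentially" using bdd by simp
  obtain F x where F: "F \<noteq> bot" "F \<le> sequentially" "limitin weak_topology X x F"
    using weak_cluster_point[OF refl _ bdd'] by auto
  have "limitin weak_topology X x sequentially"
    by (rule weakly_convergent_of_unique_cluster_point[OF refl bdd']) (use uniq F in blast)
  then show ?thesis using cluster[OF F] by blast
qed

section \<open>Expected costs and the sampling noise\<close>

lemma lower_semicontinuous_slice:
  assumes "lower_semicontinuous (\<lambda>(u, w). j u w)"
  shows "lower_semicontinuous (\<lambda>u. j u w)"
  unfolding lower_semicontinuous_def
proof (intro allI impI)
  fix x and a :: real assume "a < j x w"
  then have "eventually (\<lambda>z. a < (case z of (u, w) \<Rightarrow> j u w)) (nhds (x, w))"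
    using assms unfolding lower_semicontinuous_def by auto
  moreover have "filterlim (\<lambda>y. (y, w)) (nhds (x, w)) (nhds x)"
    by (intro tendsto_intros) (simp add: filterlim_ident)
  ultimately have "eventually (\<lambda>y. a < (case (y, w) of (u, w) \<Rightarrow> j u w)) (nhds x)"
    by (rule eventually_compose_filterlim)
  then show "\<forall>\<^sub>F y in nhds x. a < j y w" by simp
qed

lemma countable_dense_subset:
  fixes T :: "'a::second_countable_topology set"
  shows "\<exists>D\<subseteq>T. countable D \<and> T \<subseteq> closure D"
proof -
  obtain B :: "'a set set" where B: "countable B" "topological_basis B"
    using ex_countable_basis by blast
  define p where "p = (\<lambda>b. SOME x. x \<in> b \<inter> T)"
  have p: "p b \<in> b \<inter> T" if "b \<inter> T \<noteq> {}" for b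
    unfolding p_def by (rule someI_ex) (use that in blast)
  define D where "D = p ` {b \<in> B. b \<inter> T \<noteq> {}}"
  have "T \<subseteq> closure D"
  proof
    fix x assume x: "x \<in> T"
    show "x \<in> closure D"
      unfolding closure_iff_nhds_not_empty
    proof (intro allI impI)
      fix A V assume "V \<subseteq> A" "open V" "x \<in> V"
      then obtain b where b: "b \<in> B" "x \<in> b" "b \<subseteq> V" using topological_basisE[OF B(2)] by metis
      then have "p b \<in> D" "p b \<in> b" using x p[of b] by (auto simp: D_def)
      then show "D \<inter> A \<noteq> {}" using b \<open>V \<subseteq> A\<close> by blast
    qed
  qed
  moreover have "D \<subseteq> T" "countable D" using p B(1) by (auto simp: D_def)
  ultimately show ?thesis by blast
qed

lemma (in prob_space) expectation_lipschitz:
  fixes f g :: "'a \<Rightarrow> real"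
  assumes "integrable M f" "integrable M g" and "\<And>\<omega>. \<omega> \<in> space M \<Longrightarrow> \<bar>f \<omega> - g \<omega>\<bar> \<le> L"
  shows "\<bar>expectation f - expectation g\<bar> \<le> L"
proof -
  have "\<bar>expectation f - expectation g\<bar> = \<bar>expectation (\<lambda>\<omega>. f \<omega> - g \<omega>)\<bar>"
    using assms by simp
  also have "\<dots> \<le> expectation (\<lambda>\<omega>. \<bar>f \<omega> - g \<omega>\<bar>)" by (rule integral_abs_bound)
  also have "\<dots> \<le> expectation (\<lambda>\<omega>. L)"
    by (rule integral_mono) (use assms in auto)
  finally show ?thesis by (simp add: prob_space)
qed

lemma convex_on_expected_cost:
  assumes S: "convex S" and conv: "\<And>w. convex_on UNIV (\<lambda>u. j u w)"
    and int: "\<And>u. u \<in> S \<Longrightarrow> integrable M (\<lambda>\<omega>. j u (W \<omega>))"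
  shows "convex_on S (expected_cost M W j)"
  unfolding convex_on_def
proof (intro conjI S ballI allI impI)
  fix x y and s t :: real assume *: "x \<in> S" "y \<in> S" "0 \<le> s" "0 \<le> t" "s + t = 1"
  have z: "s *\<^sub>R x + t *\<^sub>R y \<in> S" using convexD[OF S] * by blast
  have "expected_cost M W j (s *\<^sub>R x + t *\<^sub>R y) \<le> (\<integral>\<omega>. s * j x (W \<omega>) + t * j y (W \<omega>) \<partial>M)"
    unfolding expected_cost_def
    by (rule integral_mono) (use int * z conv in \<open>auto simp: convex_on_def\<close>)
  also have "\<dots> = s * expected_cost M W j x + t * expected_cost M W j y"
    using int * by (simp add: expected_cost_def)
  finally show "expected_cost M W j (s *\<^sub>R x + t *\<^sub>R y)
      \<le> s * expected_cost M W j x + t * expected_cost M W j y" .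
qed

lemma continuous_on_of_growing_lipschitz:
  fixes J :: "'u::real_normed_vector \<Rightarrow> real"
  assumes lip: "\<And>u v. u \<in> S \<Longrightarrow> v \<in> S \<Longrightarrow> \<bar>J u - J v\<bar> \<le> (a * (norm u + norm v) + c) * norm (u - v)"
  shows "continuous_on S J"
  unfolding continuous_on_def
proof
  fix v assume v: "v \<in> S"
  have "((\<lambda>u. (a * (norm u + norm v) + c) * norm (u - v))
      \<longlongrightarrow> (a * (norm v + norm v) + c) * norm (v - v)) (at v within S)"
    by (intro tendsto_intros)
  then have lim: "((\<lambda>u. (a * (norm u + norm v) + c) * norm (u - v)) \<longlongrightarrow> 0) (at v within S)" by simp
  have "((\<lambda>u. J u - J v) \<longlongrightarrow> 0) (at v within S)"
  proof (rule Lim_null_comparison[OF _ lim])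
    show "\<forall>\<^sub>F u in at v within S. norm (J u - J v) \<le> (a * (norm u + norm v) + c) * norm (u - v)"
      unfolding eventually_at_filter using lip v by auto
  qed
  then show "(J \<longlongrightarrow> J v) (at v within S)" by (rule LIM_zero_cancel)
qed

text \<open>\<open>D k\<close> stands for the Bregman distance to a fixed solution and \<open>n k\<close> for the norm distance. As
  \<open>n k\<close> and \<open>(n k)^2\<close> are at most multiples of \<open>1 + D k\<close>, the recursion is of multiplicative
  type in \<open>1 + D k\<close>. The noise enters only through its ratio to \<open>1 + D k\<close>, which is the quantity
  that the probabilistic part controls.\<close>
lemma bregman_recursion_convergent:
  fixes D n \<rho> \<epsilon> \<xi> v :: "nat \<Rightarrow> real"
  assumes b: "b > 0" and a: "a \<ge> 0" "q \<ge> 0" and \<epsilon>: "\<And>k. \<epsilon> k > 0" "summable (\<lambda>k. (\<epsilon> k)\<^sup>2)"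
    and n: "\<And>k. n k \<ge> 0" "\<And>k. b / 2 * (n k)\<^sup>2 \<le> D k"
    and \<rho>: "\<And>k. \<rho> k \<ge> 0" "summable (\<lambda>k. \<epsilon> k * \<rho> k)" and v: "\<And>k. v k \<ge> 0"
    and noise: "summable (\<lambda>k. \<epsilon> k * \<xi> k / (1 + D k))"
    and step: "\<And>k. D (Suc k) \<le> D k + \<epsilon> k * (\<xi> k - v k) + \<epsilon> k * \<rho> k * n k
      + (\<epsilon> k)\<^sup>2 * (a * n k + q)\<^sup>2 / (2 * b)"
  shows "convergent D" "summable (\<lambda>k. \<epsilon> k * v k)"
proof -
  define E where "E = (\<lambda>k. 1 + D k)"
  define A where "A = 4 * a\<^sup>2 / b + 2 * q\<^sup>2"
  \<comment> \<open>The relative increments of \<open>1 + D\<close>: noise, error terms, second-order terms.\<close>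
  define c where "c = (\<lambda>k. \<epsilon> k * \<xi> k / (1 + D k) + (1 + 2 / b) * (\<epsilon> k * \<rho> k) + A / (2 * b) * (\<epsilon> k)\<^sup>2)"
  have D0: "0 \<le> D k" for k using n(2)[of k] b by (smt (verit) mult_nonneg_nonneg zero_le_power2 divide_nonneg_pos)
  have E: "1 \<le> E k" for k using D0[of k] by (simp add: E_def)
  have n2: "(n k)\<^sup>2 \<le> 2 / b * D k" for k using n(2)[of k] b by (simp add: field_simps)
  have n1: "n k \<le> (1 + 2 / b) * E k" for k
  proof -
    have "0 \<le> (n k - 1)\<^sup>2" by simp
    then have "2 * n k \<le> 1 + (n k)\<^sup>2" by (simp add: power2_diff)
    then have "n k \<le> 1 + (n k)\<^sup>2" using zero_le_power2[of "n k"] by linarith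
    also have "\<dots> \<le> 1 + 2 / b * D k" using n2[of k] by simp
    also have "\<dots> \<le> (1 + 2 / b) * E k" using D0[of k] b by (simp add: E_def distrib_left distrib_right)
    finally show ?thesis .
  qed
  have sq: "(a * n k + q)\<^sup>2 \<le> A * E k" for k
  proof -
    have "(a * n k + q)\<^sup>2 \<le> 2 * a\<^sup>2 * (n k)\<^sup>2 + 2 * q\<^sup>2"
      using zero_le_power2[of "a * n k - q"] by (simp add: power2_sum power2_diff power_mult_distrib)
    also have "2 * a\<^sup>2 * (n k)\<^sup>2 \<le> 2 * a\<^sup>2 * (2 / b * D k)" using n2[of k] by (intro mult_left_mono) auto
    also have "2 * a\<^sup>2 * (2 / b * D k) + 2 * q\<^sup>2 \<le> A * E k"
    proof -
      have "A * E k = 2 * a\<^sup>2 * (2 / b * D k) + 2 * q\<^sup>2 + (4 * a\<^sup>2 / b + 2 * q\<^sup>2 * D k)"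
        using b by (simp add: A_def E_def field_simps)
      moreover have "0 \<le> 4 * a\<^sup>2 / b + 2 * q\<^sup>2 * D k" using D0[of k] b by simp
      ultimately show ?thesis by linarith
    qed
    finally show ?thesis by simp
  qed
  have rec: "E (Suc k) \<le> (1 + c k) * E k - \<epsilon> k * v k" for k
  proof -
    have "\<epsilon> k * \<xi> k = \<epsilon> k * \<xi> k / (1 + D k) * E k" using E[of k] by (simp add: E_def)
    moreover have "\<epsilon> k * \<rho> k * n k \<le> \<epsilon> k * \<rho> k * ((1 + 2 / b) * E k)"
      using \<epsilon>(1)[of k] \<rho>(1)[of k] by (intro mult_left_mono n1) auto
    moreover have "(\<epsilon> k)\<^sup>2 * (a * n k + q)\<^sup>2 / (2 * b) \<le> (\<epsilon> k)\<^sup>2 * (A * E k) / (2 * b)"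
      using b by (intro divide_right_mono mult_left_mono sq) auto
    moreover have "(1 + c k) * E k = E k + \<epsilon> k * \<xi> k / (1 + D k) * E k
        + \<epsilon> k * \<rho> k * ((1 + 2 / b) * E k) + (\<epsilon> k)\<^sup>2 * (A * E k) / (2 * b)"
      unfolding c_def by (simp add: distrib_right distrib_left mult_ac)
    moreover have "E (Suc k) = 1 + D (Suc k)" "E k = 1 + D k" by (simp_all add: E_def)
    ultimately show ?thesis using step[of k] unfolding right_diff_distrib by linarith
  qed
  have "summable c" unfolding c_def by (intro summable_add summable_mult noise \<rho>(2) \<epsilon>(2))
  note * = multiplicative_quasi_decreasing_convergent[of E c "\<lambda>k. \<epsilon> k * v k", OF rec _ this E]
  show "summable (\<lambda>k. \<epsilon> k * v k)" by (rule *(2)) (use \<epsilon>(1) v in \<open>simp add: less_imp_le\<close>)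
  have "convergent E" by (rule *(1)) (use \<epsilon>(1) v in \<open>simp add: less_imp_le\<close>)
  then have "convergent (\<lambda>k. E k - 1)" by (intro convergent_diff convergent_const)
  then show "convergent D" by (simp add: E_def)
qed

text \<open>Given the past, \<open>U k\<close> is a constant, and the difference of the centred costs at \<open>us\<close> and at
  \<open>U k\<close> integrates to \<open>0\<close>. The weight \<open>E\<close> makes its modulus bounded, so these terms are bounded
  orthogonal increments.\<close>
lemma (in prob_space) weighted_noise_summable:
  fixes Ws :: "nat \<Rightarrow> 'a \<Rightarrow> 'w::topological_space" and j :: "'u::topological_space \<Rightarrow> 'w \<Rightarrow> real"
  assumes ind: "indep_vars (\<lambda>_. borel) Ws {1..}"
    and distr: "\<And>k. k \<ge> 1 \<Longrightarrow> distr M borel (Ws k) = \<mu>"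
    and j [measurable]: "(\<lambda>(u, w). j u w) \<in> borel_measurable (borel \<Otimes>\<^sub>M borel)"
    and int: "\<And>u. u \<in> S \<Longrightarrow> integrable \<mu> (j u)" and J: "\<And>u. u \<in> S \<Longrightarrow> J u = (\<integral>w. j u w \<partial>\<mu>)"
    and S [measurable]: "S \<in> sets borel" and us: "us \<in> S"
    and E [measurable]: "E \<in> borel_measurable borel" and E_pos: "\<And>u. E u > 0"
    and bdd: "\<And>u w. u \<in> S \<Longrightarrow> \<bar>(j us w - J us) - (j u w - J u)\<bar> \<le> C * E u"
    and U: "\<And>k. U k \<in> borel_measurable (history M Ws k)" "\<And>k \<omega>. \<omega> \<in> space M \<Longrightarrow> U k \<omega> \<in> S"
    and \<epsilon>: "\<And>k. \<epsilon> k \<ge> 0" "summable (\<lambda>k. (\<epsilon> k)\<^sup>2)"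
  shows "AE \<omega> in M. summable (\<lambda>k. \<epsilon> k *
    ((j us (Ws (Suc k) \<omega>) - J us) - (j (U k \<omega>) (Ws (Suc k) \<omega>) - J (U k \<omega>))) / E (U k \<omega>))"
proof -
  have Ws: "Ws i \<in> borel_measurable M" if "1 \<le> i" for i
    using ind that by (auto simp: indep_vars_def)
  interpret \<mu>: prob_space \<mu> using prob_space_distr[OF Ws[of 1]] distr[of 1] by simp
  have sets_\<mu> [simp, measurable_cong]: "sets \<mu> = sets borel" using distr[of 1] by (metis order_refl sets_distr)
  then have space_\<mu> [simp]: "space \<mu> = UNIV" using sets_eq_imp_space_eq[OF sets_\<mu>] by simp
  \<comment> \<open>\<open>J\<close> is known to be this integral only on \<open>S\<close>; the integral itself depends measurably on \<open>u\<close> everywhere.\<close>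
  define J' where "J' = (\<lambda>u. \<integral>w. j u w \<partial>\<mu>)"
  have J' [measurable]: "J' \<in> borel_measurable borel"
    unfolding J'_def by (rule \<mu>.borel_measurable_lebesgue_integral) (simp cong: measurable_cong_sets)
  define g where "g = (\<lambda>(u, w). if u \<in> S then ((j us w - J' us) - (j u w - J' u)) / E u else 0)"
  have us_meas [measurable]: "j us \<in> borel_measurable borel"
    using measurable_compose[OF measurable_Pair1' j, of us] by simp
  have g [measurable]: "g \<in> borel_measurable (borel \<Otimes>\<^sub>M borel)"
  proof -
    have "(\<lambda>z. j (fst z) (snd z)) \<in> borel_measurable (borel \<Otimes>\<^sub>M (borel :: 'w measure))"
      using j by (simp add: case_prod_beta')
    then show ?thesis unfolding g_def case_prod_beta' by measurable
  qed
  have C0: "0 \<le> C" using bdd[OF us] E_pos[of us] by (simp add: zero_le_mult_iff)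
  have gC: "\<bar>g z\<bar> \<le> C" for z
  proof -
    obtain u w where z: "z = (u, w)" by (cases z)
    show ?thesis
      using bdd[of u w] C0 E_pos[of u] J us by (auto simp: z g_def J'_def abs_divide pos_divide_le_eq)
  qed
  have centered: "(\<integral>w. g (u, w) \<partial>\<mu>) = 0" for u
  proof (cases "u \<in> S")
    case True
    then have "(\<integral>w. g (u, w) \<partial>\<mu>) = (\<integral>w. ((j us w - J' us) - (j u w - J' u)) / E u \<partial>\<mu>)" by (simp add: g_def)
    also have "\<dots> = 0"
      using int[OF us] int[OF True] \<mu>.prob_space by (simp add: J'_def)
    finally show ?thesis .
  qed (simp add: g_def)
  define X where "X = (\<lambda>k \<omega>. \<epsilon> k * g (U k \<omega>, Ws (Suc k) \<omega>))"
  have "AE \<omega> in M. summable (\<lambda>k. X k \<omega>)"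
  proof (rule orthogonal_increments_summable[of "history M Ws"])
    show "subalgebra M (history M Ws k)" for k by (rule subalgebra_history) (rule Ws)
    show "sets (history M Ws k) \<subseteq> sets (history M Ws (Suc k))" for k by (rule sets_history_mono) simp
    show "X k \<in> borel_measurable (history M Ws (Suc k))" for k
    proof -
      have [measurable]: "U k \<in> borel_measurable (history M Ws (Suc k))"
        by (rule measurable_history_mono[OF _ U(1)]) simp
      have [measurable]: "Ws (Suc k) \<in> borel_measurable (history M Ws (Suc k))"
        by (rule history_observation_measurable) auto
      show ?thesis unfolding X_def by measurable
    qed
    show "\<bar>X k \<omega>\<bar> \<le> \<epsilon> k * C" for k \<omega>
      using gC[of "(U k \<omega>, Ws (Suc k) \<omega>)"] \<epsilon>(1)[of k] by (simp add: X_def abs_mult mult_left_mono)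
    show "summable (\<lambda>k. (\<epsilon> k * C)\<^sup>2)"
      using summable_mult2[OF \<epsilon>(2), of "C\<^sup>2"] by (simp add: power_mult_distrib)
    fix k B and Z :: "'a \<Rightarrow> real"
    assume Z: "Z \<in> borel_measurable (history M Ws k)" and ZB: "\<And>\<omega>. \<omega> \<in> space M \<Longrightarrow> \<bar>Z \<omega>\<bar> \<le> B"
    \<comment> \<open>Truncation at \<open>B\<close> leaves the values of \<open>Z\<close> on the space of \<open>M\<close> unchanged and bounds \<open>h\<close> for all arguments.\<close>
    define h where "h = (\<lambda>((u, z), w). max (- B) (min B z) * (\<epsilon> k * g (u, w)))"
    have B0: "0 \<le> B"
    proof -
      obtain \<omega> where "\<omega> \<in> space M" using not_empty by blast
      then show ?thesis using ZB[of \<omega>] by linarith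
    qed
    have "(\<integral>\<omega>. h ((U k \<omega>, Z \<omega>), Ws (Suc k) \<omega>) \<partial>M) = 0"
    proof (rule expectation_conditionally_centered[OF ind, of _ k "borel \<Otimes>\<^sub>M borel"])
      show "(\<lambda>\<omega>. (U k \<omega>, Z \<omega>)) \<in> measurable (history M Ws k) (borel \<Otimes>\<^sub>M borel)"
        using U(1) Z by measurable
      show "h \<in> borel_measurable ((borel \<Otimes>\<^sub>M borel) \<Otimes>\<^sub>M borel)"
        unfolding h_def case_prod_beta' by measurable
      show "\<bar>h x\<bar> \<le> B * (\<epsilon> k * C)" for x
        unfolding h_def case_prod_beta' abs_mult
        using B0 C0 \<epsilon>(1)[of k] gC by (intro mult_mono) auto
      show "(\<integral>w. h (x, w) \<partial>distr M borel (Ws (Suc k))) = 0" for x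
        using distr[of "Suc k"] centered by (simp add: h_def case_prod_beta')
    qed
    moreover have "(\<integral>\<omega>. h ((U k \<omega>, Z \<omega>), Ws (Suc k) \<omega>) \<partial>M) = (\<integral>\<omega>. Z \<omega> * X k \<omega> \<partial>M)"
    proof (rule Bochner_Integration.integral_cong[OF refl])
      fix \<omega> assume "\<omega> \<in> space M"
      then have "max (- B) (min B (Z \<omega>)) = Z \<omega>" using ZB[of \<omega>] by linarith
      then show "h ((U k \<omega>, Z \<omega>), Ws (Suc k) \<omega>) = Z \<omega> * X k \<omega>" by (simp add: h_def X_def)
    qed
    ultimately show "(\<integral>\<omega>. Z \<omega> * X k \<omega> \<partial>M) = 0" by simp
  qed
  then show ?thesis
  proof (rule AE_mp, intro AE_I2 impI)
    fix \<omega> assume "\<omega> \<in> space M" "summable (\<lambda>k. X k \<omega>)"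
    then show "summable (\<lambda>k. \<epsilon> k *
      ((j us (Ws (Suc k) \<omega>) - J us) - (j (U k \<omega>) (Ws (Suc k) \<omega>) - J (U k \<omega>))) / E (U k \<omega>))"
      using U(2) us J by (simp add: X_def g_def J'_def)
  qed
qed

section \<open>Convergence of the iterates\<close>

theorem theorem4p3:
  fixes M :: "'s measure"
    and W :: "'s \<Rightarrow> 'w::real_tvs"
    and Ws :: "nat \<Rightarrow> 's \<Rightarrow> 'w"
    and Uad :: "'u::{banach, second_countable_topology} set"
    and jC jS :: "'u \<Rightarrow> 'w \<Rightarrow> real"
    and K :: "'u \<Rightarrow> real"
    and gradK :: "'u \<Rightarrow> 'u \<Rightarrow>\<^sub>L real"
    and \<epsilon> :: "nat \<Rightarrow> real"
    and R G :: "nat \<Rightarrow> 's \<Rightarrow> 'u \<Rightarrow>\<^sub>L real"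
    and U :: "nat \<Rightarrow> 's \<Rightarrow> 'u"
    and u0 :: 'u
    and b L_K :: real
  assumes reflexive: "reflexive_space TYPE('u)"
    and prob: "prob_space M" "complete_measure M"
    and Uad: "Uad \<noteq> {}" "closed Uad" "convex Uad"
    and j_lsc: "lower_semicontinuous (\<lambda>(u, w). jC u w)" "lower_semicontinuous (\<lambda>(u, w). jS u w)"
    and j_convex: "\<And>w. convex_on UNIV (\<lambda>u. jC u w)" "\<And>w. convex_on UNIV (\<lambda>u. jS u w)"
    and jC_subdiff: "\<And>w. \<exists>V. open V \<and> Uad \<subseteq> V \<and> (\<forall>u\<in>V. subdifferential (\<lambda>v. jC v w) u \<noteq> {})"
    and K: "convex_on UNIV K" "lower_semicontinuous K" "\<And>u. has_gateaux_derivative K (gradK u) u"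
    and W: "W \<in> borel_measurable M"
    and J_finite: "\<And>u. u \<in> Uad \<Longrightarrow> integrable M (\<lambda>\<omega>. jC u (W \<omega>))"
      "\<And>u. u \<in> Uad \<Longrightarrow> integrable M (\<lambda>\<omega>. jS u (W \<omega>))"
    and Ws_indep: "prob_space.indep_vars M (\<lambda>_. borel) Ws {1..}"
    and Ws_distr: "\<And>k. k \<ge> 1 \<Longrightarrow> distr M borel (Ws k) = distr M borel W"
    and U_init: "u0 \<in> Uad" "\<And>\<omega>. \<omega> \<in> space M \<Longrightarrow> U 0 \<omega> = u0"
    and G_meas: "\<And>k. G k \<in> borel_measurable M"
    and G_subgrad: "\<And>k \<omega>. \<omega> \<in> space M \<Longrightarrow>
      G k \<omega> \<in> subdifferential (\<lambda>v. jC v (Ws (Suc k) \<omega>)) (U k \<omega>)"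
    and step_coercive: "\<And>k \<omega>. \<omega> \<in> space M \<Longrightarrow>
      coercive_on Uad
        (app_objective K gradK jS (\<epsilon> k) (G k \<omega>) (R k \<omega>) (U k \<omega>) (Ws (Suc k) \<omega>))"
    and U_step: "\<And>k \<omega>. \<omega> \<in> space M \<Longrightarrow>
      is_arg_min
        (app_objective K gradK jS (\<epsilon> k) (G k \<omega>) (R k \<omega>) (U k \<omega>) (Ws (Suc k) \<omega>))
        (\<lambda>u. u \<in> Uad) (U (Suc k) \<omega>)"
    and U_adapted: "\<And>k. U k \<in> borel_measurable (history M Ws k)"
    and a_C: "\<exists>c1>0. \<exists>c2>0. \<forall>u\<in>Uad. \<forall>w. \<forall>r\<in>subdifferential (\<lambda>v. jC v w) u.
      norm r \<le> c1 * norm u + c2"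
    and a_S: "\<exists>d1>0. \<exists>d2>0. \<forall>u\<in>Uad. \<forall>w. \<forall>s\<in>subdifferential (\<lambda>v. jS v w) u.
      norm s \<le> d1 * norm u + d2"
    and b: "coercive_on Uad (total_cost M W jC jS)"
    and c_strong: "b > 0"
      "\<And>u v. K v \<ge> K u + blinfun_apply (gradK u) (v - u) + b / 2 * (norm (u - v))\<^sup>2"
    and c_Lip: "L_K > 0" "\<And>u v. norm (gradK v - gradK u) \<le> L_K * norm (v - u)"
    and d: "\<And>k. \<epsilon> k > 0" "filterlim (\<lambda>n. \<Sum>k<n. \<epsilon> k) at_top sequentially"
      "summable (\<lambda>k. (\<epsilon> k)\<^sup>2)"
    and e_meas: "\<And>k. R k \<in> borel_measurable (history M Ws (Suc k))"
    and e_bounded: "AE \<omega> in M. bounded (range (\<lambda>k. R k \<omega>))"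
    and e_sum: "AE \<omega> in M.
      (\<Sum>k. ennreal (\<epsilon> k) * nn_cond_exp M (history M Ws k) (\<lambda>\<omega>'. ennreal (norm (R k \<omega>'))) \<omega>) < \<infinity>"
    and f: "continuous_map weak_topology weak_topology gradK"
  shows "(AE \<omega> in M. \<exists>u. is_arg_min (total_cost M W jC jS) (\<lambda>v. v \<in> Uad) u \<and>
             limitin weak_topology (\<lambda>k. U k \<omega>) u sequentially) \<and>
         ((\<exists>B>0. strongly_convex_on Uad B (expected_cost M W jC)) \<longrightarrow>
           (\<exists>us. {u. is_arg_min (total_cost M W jC jS) (\<lambda>v. v \<in> Uad) u} = {us} \<and>
             (AE \<omega> in M. (\<lambda>k. U k \<omega>) \<longlonglongrightarrow> us)))"
proof -
  interpret prob_space M by (rule prob)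
  define J where "J = total_cost M W jC jS"
  define j where "j = (\<lambda>u w. jC u w + jS u w)"
  define \<mu> where "\<mu> = distr M borel W"
  define Sol where "Sol = {u. is_arg_min J (\<lambda>v. v \<in> Uad) u}"
  have Ws: "Ws i \<in> borel_measurable M" if "1 \<le> i" for i
    using Ws_indep that by (auto simp: indep_vars_def)
  have sub: "subalgebra M (history M Ws k)" for k by (rule subalgebra_history) (rule Ws)
  have Uin: "U k \<omega> \<in> Uad" if "\<omega> \<in> space M" for k \<omega>
    using U_step[OF that, of "k - 1"] U_init that by (cases k) (auto simp: is_arg_min_linorder)

  obtain c1 c2 where c: "c1 > 0" "c2 > 0"
      "\<And>u w r. u \<in> Uad \<Longrightarrow> r \<in> subdifferential (\<lambda>v. jC v w) u \<Longrightarrow> norm r \<le> c1 * norm u + c2"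
    using a_C by blast
  obtain d1 d2 where d12: "d1 > 0" "d2 > 0"
      "\<And>u w r. u \<in> Uad \<Longrightarrow> r \<in> subdifferential (\<lambda>v. jS v w) u \<Longrightarrow> norm r \<le> d1 * norm u + d2"
    using a_S by blast
  define a1 where "a1 = c1 + d1"
  define a2 where "a2 = c2 + d2"
  have a: "a1 \<ge> 0" "a2 \<ge> 0" using c d12 by (auto simp: a1_def a2_def)
  \<comment> \<open>The growth conditions have content only because subgradients exist; then they make the costs Lipschitz on bounded sets.\<close>
  have ne: "subdifferential (\<lambda>v. jC v w) u \<noteq> {}" "subdifferential (\<lambda>v. jS v w) u \<noteq> {}" for u w
    by (rule subdifferential_nonempty_lsc[OF j_convex(1) lower_semicontinuous_slice[OF j_lsc(1)]],
        rule subdifferential_nonempty_lsc[OF j_convex(2) lower_semicontinuous_slice[OF j_lsc(2)]])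
  have lip: "\<bar>j u w - j v w\<bar> \<le> (a1 * (norm u + norm v) + a2) * norm (u - v)"
    if "u \<in> Uad" "v \<in> Uad" for u v w
  proof -
    have "\<bar>jC u w - jC v w\<bar> \<le> (c1 * (norm u + norm v) + c2) * norm (u - v)"
      by (rule subgradient_growth_lipschitz[of Uad "\<lambda>v. jC v w"]) (use ne c that in \<open>auto simp: less_imp_le\<close>)
    moreover have "\<bar>jS u w - jS v w\<bar> \<le> (d1 * (norm u + norm v) + d2) * norm (u - v)"
      by (rule subgradient_growth_lipschitz[of Uad "\<lambda>v. jS v w"]) (use ne d12 that in \<open>auto simp: less_imp_le\<close>)
    moreover have "(a1 * (norm u + norm v) + a2) * norm (u - v)
        = (c1 * (norm u + norm v) + c2) * norm (u - v) + (d1 * (norm u + norm v) + d2) * norm (u - v)"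
      by (simp add: a1_def a2_def algebra_simps)
    ultimately show ?thesis unfolding j_def by linarith
  qed

  have int_j: "integrable M (\<lambda>\<omega>. j u (W \<omega>))" if "u \<in> Uad" for u
    using J_finite that by (simp add: j_def)
  have J_eq: "J u = expected_cost M W j u" if "u \<in> Uad" for u
    using J_finite[OF that] by (simp add: J_def total_cost_def expected_cost_def j_def)
  have j_meas: "(\<lambda>(u, w). j u w) \<in> borel_measurable (borel \<Otimes>\<^sub>M borel)"
  proof -
    have "(\<lambda>z. (\<lambda>(u, w). jC u w) z + (\<lambda>(u, w). jS u w) z) \<in> borel_measurable (borel \<Otimes>\<^sub>M borel)"
      by (intro borel_measurable_add lower_semicontinuous_pair_measurable j_lsc)
    then show ?thesis by (simp add: j_def case_prod_beta')
  qed
  have slice: "j u \<in> borel_measurable borel" for u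
    using measurable_compose[OF measurable_Pair1' j_meas, of u] by simp
  have int_\<mu>: "integrable \<mu> (j u)" and J_\<mu>: "J u = (\<integral>w. j u w \<partial>\<mu>)" if "u \<in> Uad" for u
    using int_j[OF that] J_eq[OF that] W slice[of u]
    by (simp_all add: \<mu>_def integrable_distr_eq integral_distr expected_cost_def)
  have J_lip: "\<bar>J u - J v\<bar> \<le> (a1 * (norm u + norm v) + a2) * norm (u - v)"
    if "u \<in> Uad" "v \<in> Uad" for u v
    unfolding J_eq[OF that(1)] J_eq[OF that(2)] expected_cost_def
    by (rule expectation_lipschitz) (use int_j lip that in auto)
  have J_cont: "continuous_on Uad J" by (rule continuous_on_of_growing_lipschitz[OF J_lip])
  have J_conv: "convex_on Uad J"
  proof -
    have C: "convex_on Uad (expected_cost M W jC)" and S: "convex_on Uad (expected_cost M W jS)"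
      by (intro convex_on_expected_cost Uad j_convex J_finite; assumption)+
    show ?thesis using convex_on_add[OF C S] by (simp add: J_def total_cost_def[abs_def])
  qed
  obtain us0 where us0: "us0 \<in> Sol"
    using convex_coercive_attains_min[OF reflexive Uad(1,2) J_conv J_cont] b by (auto simp: J_def Sol_def)
  have Sol_Uad: "u \<in> Uad" and Sol_min: "v \<in> Uad \<Longrightarrow> J u \<le> J v" if "u \<in> Sol" for u v
    using that by (auto simp: Sol_def is_arg_min_linorder)
  have Sol_eq: "J u = J us0" if "u \<in> Sol" for u
    using Sol_min[OF that Sol_Uad[OF us0]] Sol_min[OF us0 Sol_Uad[OF that]] by simp
  have SolI: "u \<in> Sol" if "u \<in> Uad" "J u \<le> J us0" for u
    using that Sol_min[OF us0] by (force simp: Sol_def is_arg_min_linorder)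

  have gradK_cont: "continuous_on UNIV gradK"
    by (rule lipschitz_on_continuous_on[of L_K]) (use c_Lip in \<open>auto intro!: lipschitz_onI simp: dist_norm\<close>)
  have K_grad: "K u + blinfun_apply (gradK u) (v - u) \<le> K v" for u v
    using c_strong(2)[of u v] c_strong(1) by (smt (verit) zero_le_power2 mult_nonneg_nonneg divide_nonneg_pos)
  have K_cont: "continuous_on UNIV K" by (rule continuous_of_gradient_inequality[OF gradK_cont K_grad])
  have breg_ge: "b / 2 * (norm (u - x))\<^sup>2 \<le> bregman K gradK u x" for u x
    using c_strong(2)[of x u] by (simp add: bregman_def norm_minus_commute)
  then have breg_0: "0 \<le> bregman K gradK u x" for u x
    using c_strong(1) by (smt (verit) zero_le_power2 mult_nonneg_nonneg divide_nonneg_pos)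
  have breg_meas: "(\<lambda>x. 1 + bregman K gradK u x) \<in> borel_measurable borel" for u
    unfolding bregman_def
    by (rule borel_measurable_continuous_onI) (intro continuous_intros K_cont gradK_cont)

  \<comment> \<open>The noise is measured relative to a fixed solution \<open>us\<close>; its weighted sums converge for that solution almost surely.\<close>
  define noise where "noise = (\<lambda>us k \<omega>. (j us (Ws (Suc k) \<omega>) - J us) - (j (U k \<omega>) (Ws (Suc k) \<omega>) - J (U k \<omega>)))"
  have AE_noise: "AE \<omega> in M. summable (\<lambda>k. \<epsilon> k * noise us k \<omega> / (1 + bregman K gradK us (U k \<omega>)))"
    if us: "us \<in> Sol" for us
  proof -
    \<comment> \<open>Collects \<open>norm (us - u)^2 \<le> 2/b * D\<close> and \<open>norm (us - u) \<le> (1 + 2/b) * (1 + D)\<close> in the Lipschitz bound.\<close>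
    define C where "C = 4 * a1 / b + 2 * (2 * a1 * norm us + a2) * (1 + 2 / b)"
    have "\<bar>(j us w - J us) - (j u w - J u)\<bar> \<le> C * (1 + bregman K gradK us u)" if u: "u \<in> Uad" for u w
    proof -
      define n where "n = norm (us - u)"
      define D where "D = bregman K gradK us u"
      have D0: "0 \<le> D" unfolding D_def by (rule breg_0)
      have n2: "n\<^sup>2 \<le> 2 / b * D" using breg_ge[of us u] c_strong(1) by (simp add: n_def D_def field_simps)
      have n1: "n \<le> (1 + 2 / b) * (1 + D)"
      proof -
        have "0 \<le> (n - 1)\<^sup>2" by simp
        then have "2 * n \<le> 1 + n\<^sup>2" by (simp add: power2_diff)
        then have "n \<le> 1 + 2 / b * D" using n2 by (simp add: n_def) (smt (verit) norm_ge_zero)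
        also have "\<dots> \<le> (1 + 2 / b) * (1 + D)" using D0 c_strong(1) by (simp add: distrib_left distrib_right)
        finally show ?thesis .
      qed
      have nu: "norm u \<le> norm us + n" unfolding n_def using norm_triangle_ineq4[of us "us - u"] by simp
      have "\<bar>(j us w - J us) - (j u w - J u)\<bar> \<le> 2 * ((a1 * (norm us + norm u) + a2) * n)"
        using lip[OF Sol_Uad[OF us] u, of w] J_lip[OF Sol_Uad[OF us] u] unfolding n_def by linarith
      also have "\<dots> \<le> 2 * ((a1 * (norm us + (norm us + n)) + a2) * n)"
        using a nu by (intro mult_left_mono mult_right_mono add_mono) (auto simp: n_def)
      also have "\<dots> = 2 * a1 * n\<^sup>2 + 2 * (2 * a1 * norm us + a2) * n"
        by (simp add: power2_eq_square algebra_simps)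
      also have "\<dots> \<le> 2 * a1 * (2 / b * D) + 2 * (2 * a1 * norm us + a2) * ((1 + 2 / b) * (1 + D))"
        using a n1 n2 by (intro add_mono mult_left_mono) auto
      also have "\<dots> \<le> 2 * a1 * (2 / b * (1 + D)) + 2 * (2 * a1 * norm us + a2) * ((1 + 2 / b) * (1 + D))"
        using a c_strong(1) by (intro add_right_mono mult_left_mono) auto
      also have "\<dots> = C * (1 + D)" by (simp add: C_def algebra_simps)
      finally show ?thesis by (simp add: D_def)
    qed
    then show ?thesis
      unfolding noise_def
      by (intro weighted_noise_summable[of Ws \<mu> j Uad J us "\<lambda>u. 1 + bregman K gradK us u" C U \<epsilon>])
        (use Ws_indep Ws_distr j_meas int_\<mu> J_\<mu> Uad(2) Sol_Uad[OF us] breg_meas breg_0 U_adapted Uin d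
          in \<open>auto simp: \<mu>_def less_imp_le add_pos_nonneg\<close>)
  qed

  have AE_R: "AE \<omega> in M. summable (\<lambda>k. \<epsilon> k * norm (R k \<omega>))"
  proof -
    have [measurable]: "R k \<in> borel_measurable M" for k by (rule measurable_from_subalg[OF sub e_meas])
    have nR: "(\<lambda>\<omega>. ennreal (norm (R k \<omega>))) \<in> borel_measurable M" for k
      by (intro measurable_compose[OF _ measurable_ennreal]
          measurable_compose[OF _ borel_measurable_continuous_onI[OF continuous_on_norm_id]]) measurable
    have "AE \<omega> in M. (\<Sum>k. ennreal (\<epsilon> k) * ennreal (norm (R k \<omega>))) < \<infinity>"
      by (rule suminf_finite_of_cond_exp[OF sub sets_history_mono nR e_sum])
    then show ?thesis
    proof eventually_elim
      case (elim \<omega>)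
      then have "(\<Sum>k. ennreal (\<epsilon> k * norm (R k \<omega>))) \<noteq> top"
        using d(1) by (simp add: ennreal_mult less_imp_le)
      then show ?case using d(1) by (intro summable_suminf_not_top) (auto simp: less_imp_le)
    qed
  qed

  have step: "norm (U (Suc k) \<omega> - U k \<omega>) \<le> \<epsilon> k * (a1 * norm (U k \<omega>) + a2 + norm (R k \<omega>)) / b"
      "u \<in> Uad \<Longrightarrow> bregman K gradK u (U (Suc k) \<omega>) \<le> bregman K gradK u (U k \<omega>)
        + \<epsilon> k * (j u (Ws (Suc k) \<omega>) - j (U k \<omega>) (Ws (Suc k) \<omega>)) + \<epsilon> k * norm (R k \<omega>) * norm (u - U k \<omega>)
        + (\<epsilon> k)\<^sup>2 * (a1 * norm (U k \<omega>) + a2 + norm (R k \<omega>))\<^sup>2 / (2 * b)"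
    if \<omega>: "\<omega> \<in> space M" for k \<omega> u
  proof -
    define w where "w = Ws (Suc k) \<omega>"
    obtain s where s: "s \<in> subdifferential (\<lambda>v. jS v w) (U k \<omega>)" using ne(2) by blast
    have g: "G k \<omega> \<in> subdifferential (\<lambda>v. jC v w) (U k \<omega>)" using G_subgrad[OF \<omega>] by (simp add: w_def)
    have A: "norm (G k \<omega>) + norm s \<le> a1 * norm (U k \<omega>) + a2"
      using c(3)[OF Uin[OF \<omega>] g] d12(3)[OF Uin[OF \<omega>] s] by (simp add: a1_def a2_def distrib_right)
    have vi: "0 \<le> blinfun_apply (gradK (U (Suc k) \<omega>)) (v - U (Suc k) \<omega>)
        + blinfun_apply (\<epsilon> k *\<^sub>R (G k \<omega> + R k \<omega>) - gradK (U k \<omega>)) (v - U (Suc k) \<omega>)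
        + \<epsilon> k * (jS v w - jS (U (Suc k) \<omega>) w)" if "v \<in> Uad" for v
      by (rule variational_inequality[OF Uad(3) K(3) j_convex(2) _ _ that])
        (use U_step[OF \<omega>, of k] d(1)[of k] in \<open>auto simp: app_objective_def[abs_def] w_def less_imp_le\<close>)
    have e: "0 \<le> \<epsilon> k" using d(1)[of k] by simp
    note est = app_step_estimates[where S = Uad, OF c_strong(1) e c_strong(2) vi g s A]
    show "norm (U (Suc k) \<omega> - U k \<omega>) \<le> \<epsilon> k * (a1 * norm (U k \<omega>) + a2 + norm (R k \<omega>)) / b"
      by (rule est(1)) (use Uin[OF \<omega>] in auto)
    show "bregman K gradK u (U (Suc k) \<omega>) \<le> bregman K gradK u (U k \<omega>)
        + \<epsilon> k * (j u (Ws (Suc k) \<omega>) - j (U k \<omega>) (Ws (Suc k) \<omega>)) + \<epsilon> k * norm (R k \<omega>) * norm (u - U k \<omega>)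
        + (\<epsilon> k)\<^sup>2 * (a1 * norm (U k \<omega>) + a2 + norm (R k \<omega>))\<^sup>2 / (2 * b)" if "u \<in> Uad"
      using est(2)[of u] that by (simp add: j_def w_def)
  qed

  \<comment> \<open>The argument on a single path: randomness enters only through the three properties assumed of it.\<close>
  have path: "convergent (\<lambda>k. bregman K gradK us (U k \<omega>))" "summable (\<lambda>k. \<epsilon> k * (J (U k \<omega>) - J us))"
    if us: "us \<in> Sol" and \<omega>: "\<omega> \<in> space M" and R: "bounded (range (\<lambda>k. R k \<omega>))"
      and sum_R: "summable (\<lambda>k. \<epsilon> k * norm (R k \<omega>))"
      and sum_noise: "summable (\<lambda>k. \<epsilon> k * noise us k \<omega> / (1 + bregman K gradK us (U k \<omega>)))" for us \<omega>
  proof -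
    obtain B where B: "\<And>k. norm (R k \<omega>) \<le> B" using R by (auto simp: bounded_iff)
    have B0: "0 \<le> B" using B[of 0] norm_ge_zero order_trans by blast
    define q where "q = a1 * norm us + a2 + B"
    have q0: "0 \<le> q" using a B0 by (simp add: q_def)
    have rec: "bregman K gradK us (U (Suc k) \<omega>) \<le> bregman K gradK us (U k \<omega>)
        + \<epsilon> k * (noise us k \<omega> - (J (U k \<omega>) - J us)) + \<epsilon> k * norm (R k \<omega>) * norm (us - U k \<omega>)
        + (\<epsilon> k)\<^sup>2 * (a1 * norm (us - U k \<omega>) + q)\<^sup>2 / (2 * b)" for k
    proof -
      have "norm (U k \<omega>) \<le> norm us + norm (us - U k \<omega>)"
        using norm_triangle_ineq4[of us "us - U k \<omega>"] by simp
      then have "a1 * norm (U k \<omega>) \<le> a1 * (norm us + norm (us - U k \<omega>))"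
        using a(1) by (rule mult_left_mono)
      then have le: "a1 * norm (U k \<omega>) + a2 + norm (R k \<omega>) \<le> a1 * norm (us - U k \<omega>) + q"
        using B[of k] by (simp add: q_def distrib_left)
      have "(\<epsilon> k)\<^sup>2 * (a1 * norm (U k \<omega>) + a2 + norm (R k \<omega>))\<^sup>2 / (2 * b)
          \<le> (\<epsilon> k)\<^sup>2 * (a1 * norm (us - U k \<omega>) + q)\<^sup>2 / (2 * b)"
        using le a c_strong(1) by (intro divide_right_mono mult_left_mono power_mono) auto
      moreover have eq: "noise us k \<omega> - (J (U k \<omega>) - J us) = j us (Ws (Suc k) \<omega>) - j (U k \<omega>) (Ws (Suc k) \<omega>)"
        by (simp add: noise_def)
      ultimately show ?thesis using step(2)[OF \<omega> Sol_Uad[OF us], of k] unfolding eq by linarith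
    qed
    have v: "0 \<le> J (U k \<omega>) - J us" for k using Sol_min[OF us Uin[OF \<omega>, of k]] by simp
    note * = bregman_recursion_convergent[of b a1 q \<epsilon> "\<lambda>k. norm (us - U k \<omega>)"
        "\<lambda>k. bregman K gradK us (U k \<omega>)" "\<lambda>k. norm (R k \<omega>)" "\<lambda>k. J (U k \<omega>) - J us" "\<lambda>k. noise us k \<omega>",
        OF c_strong(1) a(1) q0 d(1) d(3) norm_ge_zero breg_ge norm_ge_zero sum_R v sum_noise rec]
    show "convergent (\<lambda>k. bregman K gradK us (U k \<omega>))" by (rule *(1))
    show "summable (\<lambda>k. \<epsilon> k * (J (U k \<omega>) - J us))" by (rule *(2))
  qed

  \<comment> \<open>One null set serves all solutions in a countable dense set \<open>D\<close>.\<close>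
  obtain D where D: "D \<subseteq> Sol" "countable D" "Sol \<subseteq> closure D"
    using countable_dense_subset[of Sol] by blast
  have "D \<noteq> {}" using D(3) us0 by auto
  have AE_D: "AE \<omega> in M. \<forall>us\<in>D. summable (\<lambda>k. \<epsilon> k * noise us k \<omega> / (1 + bregman K gradK us (U k \<omega>)))"
    using AE_noise D(1) by (subst AE_ball_countable[OF D(2)]) auto
  have main: "AE \<omega> in M. (\<lambda>k. J (U k \<omega>)) \<longlonglongrightarrow> J us0 \<and>
      (\<exists>u\<in>Sol. limitin weak_topology (\<lambda>k. U k \<omega>) u sequentially)"
    using AE_space e_bounded AE_R AE_D
  proof eventually_elim
    case (elim \<omega>)
    note path' = path[OF subsetD[OF D(1)] elim(1,2,3) elim(4)[rule_format]]
    obtain u1 where u1: "u1 \<in> D" using \<open>D \<noteq> {}\<close> by blast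
    obtain B where B: "\<And>k. \<bar>bregman K gradK u1 (U k \<omega>)\<bar> \<le> B"
      using convergent_imp_Bseq[OF path'(1)[OF u1 u1]] by (force simp: Bseq_def)
    obtain C where C: "\<And>k. norm (U k \<omega>) \<le> C"
    proof
      fix k
      have "(norm (u1 - U k \<omega>))\<^sup>2 \<le> 2 / b * B"
        using breg_ge[of u1 "U k \<omega>"] B[of k] c_strong(1) by (simp add: field_simps abs_le_iff)
      then have "norm (u1 - U k \<omega>) \<le> sqrt (2 / b * B)" by (rule real_le_rsqrt)
      then show "norm (U k \<omega>) \<le> norm u1 + sqrt (2 / b * B)"
        using norm_triangle_ineq4[of u1 "u1 - U k \<omega>"] by simp
    qed
    have C0: "0 \<le> C" using C[of 0] norm_ge_zero order_trans by blast
    obtain BR where BR: "\<And>k. norm (R k \<omega>) \<le> BR" using elim(2) by (auto simp: bounded_iff)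
    have J_lim: "(\<lambda>k. J (U k \<omega>)) \<longlonglongrightarrow> J us0"
    proof -
      have "(\<lambda>k. J (U k \<omega>) - J us0) \<longlonglongrightarrow> 0"
      proof (rule tendsto_0_of_weighted_summable[OF d])
        show "0 \<le> J (U k \<omega>) - J us0" for k using Sol_min[OF us0 Uin[OF elim(1), of k]] by simp
        show "summable (\<lambda>k. \<epsilon> k * (J (U k \<omega>) - J us0))"
          using path'(2)[OF u1 u1] Sol_eq[OF subsetD[OF D(1) u1]] by simp
        fix k
        have "J (U (Suc k) \<omega>) - J (U k \<omega>)
            \<le> (a1 * (norm (U (Suc k) \<omega>) + norm (U k \<omega>)) + a2) * norm (U (Suc k) \<omega> - U k \<omega>)"
          using J_lip[OF Uin Uin, OF elim(1) elim(1), of "Suc k" k] by linarith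
        also have "\<dots> \<le> (a1 * (C + C) + a2) * (\<epsilon> k * (a1 * C + a2 + BR) / b)"
        proof (rule mult_mono)
          show "a1 * (norm (U (Suc k) \<omega>) + norm (U k \<omega>)) + a2 \<le> a1 * (C + C) + a2"
            using a C by (intro add_mono mult_left_mono) auto
          have "\<epsilon> k * (a1 * norm (U k \<omega>) + a2 + norm (R k \<omega>)) / b \<le> \<epsilon> k * (a1 * C + a2 + BR) / b"
            using a C BR d(1)[of k] c_strong(1)
            by (intro divide_right_mono mult_left_mono add_mono) (auto simp: less_imp_le)
          then show "norm (U (Suc k) \<omega> - U k \<omega>) \<le> \<epsilon> k * (a1 * C + a2 + BR) / b"
            using step(1)[OF elim(1), of k] by linarith
        qed (use a C0 in auto)
        also have "\<dots> = (a1 * (C + C) + a2) * ((a1 * C + a2 + BR) / b) * \<epsilon> k" by simp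
        finally show "J (U (Suc k) \<omega>) - J us0
            \<le> J (U k \<omega>) - J us0 + (a1 * (C + C) + a2) * ((a1 * C + a2 + BR) / b) * \<epsilon> k"
          by linarith
      qed
      then show ?thesis by (rule LIM_zero_cancel)
    qed
    have gradK_bdd: "norm (gradK (U k \<omega>)) \<le> norm (gradK 0) + L_K * C" for k
    proof -
      have "norm (gradK (U k \<omega>)) \<le> norm (gradK 0) + norm (gradK (U k \<omega>) - gradK 0)"
        using norm_triangle_ineq[of "gradK 0" "gradK (U k \<omega>) - gradK 0"] by simp
      also have "norm (gradK (U k \<omega>) - gradK 0) \<le> L_K * norm (U k \<omega>)" using c_Lip(2)[of "U k \<omega>" 0] by simp
      also have "\<dots> \<le> L_K * C" using C c_Lip(1) by simp
      finally show ?thesis by simp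
    qed
    have conv: "convergent (\<lambda>k. bregman K gradK u (U k \<omega>))" if "u \<in> Sol" for u
      by (rule convergent_bregman_closure[OF K_cont gradK_bdd path'(1)]) (use that D(3) in auto)
    have cluster: "x \<in> Sol" if F: "F \<noteq> bot" "F \<le> sequentially" "limitin weak_topology (\<lambda>k. U k \<omega>) x F" for F x
    proof -
      have "x \<in> {u \<in> Uad. J u \<le> J us0 + e}" if "e > 0" for e
      proof (rule weak_limit_in_closed_convex[OF sublevel_closed_convex[OF Uad(2) J_conv J_cont] F(1) _ F(3)])
        have "eventually (\<lambda>k. J (U k \<omega>) < J us0 + e) sequentially"
          by (rule order_tendstoD(2)[OF J_lim]) (use that in simp)
        then have "eventually (\<lambda>k. U k \<omega> \<in> {u \<in> Uad. J u \<le> J us0 + e}) sequentially"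
          by eventually_elim (use Uin[OF elim(1)] in auto)
        then show "eventually (\<lambda>k. U k \<omega> \<in> {u \<in> Uad. J u \<le> J us0 + e}) F" by (rule filter_leD[OF F(2)])
      qed
      then have "x \<in> Uad" "J x \<le> J us0" using zero_less_one by (blast, auto intro: field_le_epsilon)
      then show ?thesis by (rule SolI)
    qed
    have "\<exists>u\<in>Sol. limitin weak_topology (\<lambda>k. U k \<omega>) u sequentially"
      by (rule weakly_convergent_of_bregman_convergent[OF reflexive c_strong f C conv cluster])
    with J_lim show ?case by blast
  qed

  have strong: "\<exists>us. Sol = {us} \<and> (AE \<omega> in M. (\<lambda>k. U k \<omega>) \<longlonglongrightarrow> us)"
    if B: "B > 0" "strongly_convex_on Uad B (expected_cost M W jC)" for B
  proof -
    have growth: "B / 4 * (norm (u - us0))\<^sup>2 \<le> J u - J us0" if u: "u \<in> Uad" for u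
    proof -
      \<comment> \<open>Strong convexity at the midpoint of \<open>u\<close> and the solution, where the cost is at least the minimum.\<close>
      define m where "m = (1/2) *\<^sub>R u + (1 - 1/2 :: real) *\<^sub>R us0"
      have us0': "us0 \<in> Uad" by (rule Sol_Uad[OF us0])
      have S: "convex_on Uad (expected_cost M W jS)"
        by (intro convex_on_expected_cost Uad j_convex J_finite; assumption)
      have "expected_cost M W jS m \<le> 1/2 * expected_cost M W jS u + 1/2 * expected_cost M W jS us0"
        using convex_onD[OF S, of "1/2" u us0] u us0' by (simp add: m_def add.commute)
      moreover have "expected_cost M W jC m \<le> 1/2 * expected_cost M W jC u + (1 - 1/2) * expected_cost M W jC us0
          - B / 2 * (1/2) * (1 - 1/2) * (norm (u - us0))\<^sup>2"
        unfolding m_def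
        by (rule B(2)[unfolded strongly_convex_on_def, THEN conjunct2, rule_format, OF u us0']) simp
      ultimately have "J m \<le> (J u + J us0) / 2 - B / 8 * (norm (u - us0))\<^sup>2"
        by (simp add: J_def total_cost_def add_divide_distrib)
      moreover have "m \<in> Uad" unfolding m_def using convexD[OF Uad(3) u us0', of "1/2" "1/2"] by simp
      then have "J us0 \<le> J m" by (rule Sol_min[OF us0])
      ultimately have "J us0 \<le> (J u + J us0) / 2 - B / 8 * (norm (u - us0))\<^sup>2" by linarith
      then show ?thesis by (simp add: field_simps)
    qed
    have "u = us0" if "u \<in> Sol" for u
    proof -
      have "B / 4 * (norm (u - us0))\<^sup>2 \<le> 0" using growth[OF Sol_Uad[OF that]] Sol_eq[OF that] by simp
      then show ?thesis using B(1) by (simp add: mult_le_0_iff)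
    qed
    then have "Sol = {us0}" using us0 by blast
    moreover have "AE \<omega> in M. (\<lambda>k. U k \<omega>) \<longlonglongrightarrow> us0"
      using main AE_space
    proof eventually_elim
      case (elim \<omega>)
      have "(\<lambda>k. sqrt (4 / B * (J (U k \<omega>) - J us0))) \<longlonglongrightarrow> sqrt (4 / B * (J us0 - J us0))"
        by (intro tendsto_intros conjunct1[OF elim(1)])
      then have lim: "(\<lambda>k. sqrt (4 / B * (J (U k \<omega>) - J us0))) \<longlonglongrightarrow> 0" by simp
      have "norm (U k \<omega> - us0) \<le> sqrt (4 / B * (J (U k \<omega>) - J us0))" for k
        by (rule real_le_rsqrt) (use growth[OF Uin[OF elim(2), of k]] B(1) in \<open>simp add: field_simps\<close>)
      then have "(\<lambda>k. U k \<omega> - us0) \<longlonglongrightarrow> 0" by (intro Lim_null_comparison[OF _ lim]) simp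
      then show ?case by (rule LIM_zero_cancel)
    qed
    ultimately show ?thesis by blast
  qed

  show ?thesis
  proof (intro conjI impI)
    show "AE \<omega> in M. \<exists>u. is_arg_min (total_cost M W jC jS) (\<lambda>v. v \<in> Uad) u \<and>
        limitin weak_topology (\<lambda>k. U k \<omega>) u sequentially"
      using main by eventually_elim (auto simp: Sol_def J_def)
    show "\<exists>us. {u. is_arg_min (total_cost M W jC jS) (\<lambda>v. v \<in> Uad) u} = {us} \<and>
        (AE \<omega> in M. (\<lambda>k. U k \<omega>) \<longlonglongrightarrow> us)"
      if "\<exists>B>0. strongly_convex_on Uad B (expected_cost M W jC)"
      using that strong by (auto simp: Sol_def J_def)
  qed
qed

end
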